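(* If $\mathsf p:\mathbb E\to\mathbb B$ is a latent hyperfibration, then the double fibrational dual $\mathbb E^{**}=(\mathbb E^* )^*$ (the dual of the latent hyperfibration $\mathsf p^*:\mathbb E^*\to\mathbb B$) is isomorphic to $\mathbb E$.
   Context: Isomorphic means isomorphic as restriction categories. Composition is written in diagrammatic order. A restriction category is a category with an operation sending each $f:A\to B$ to $\overline f:A\to A$ such that (R.1) $\overline f f=f$; (R.2) $\overline f\,\overline g=\overline g\,\overline f$ for $f,g$ with the same domain; (R.3) $\overline{\overline f g}=\overline f\,\overline g$ for $f,g$ with the same domain; (R.4) $f\overline g=\overline{fg}\,f$ for composable $f,g$. A restriction idempotent is an endomap $e=\overline e$; $\mathcal O(X)$ is the set of restriction idempotents on $X$. Parallel maps are ordered by $f\le g$ iff $\overline f g=f$. A partial isomorphism is a map $s$ with a (unique) partial inverse $s^{(-1)}$: $ss^{(-1)}=\overline s$, $s^{(-1)}s=\overline{s^{(-1)}}$. A restriction semifunctor preserves domains, codomains, composition and restriction, but not necessarily identities. A commuting triangle $kf=g$ (with left factor $k$) is precise if $\overline g=\overline k$. For a restriction semifunctor $\mathsf p:\mathbb E\to\mathbb B$, an arrow $f':X'\to X$ of $\mathbb E$ is $\mathsf p$-prone if whenever $g:Y\to X$ in $\mathbb E$ and $h:\mathsf p(Y)\to\mathsf p(X')$ in $\mathbb B$ are such that $h\,\mathsf p(f')=\mathsf p(g)$ is precise, there is a unique $\widetilde h:Y\to X'$ with $\mathsf p(\widetilde h)=h$ and $\widetilde h f'=g$ precise. $\mathsf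 p$ is a latent fibration if for each $X\in\mathbb E$ and $f:A\to\mathsf p(X)$ in $\mathbb B$ with $f=f\,\mathsf p(1_X)$ there is a $\mathsf p$-prone $f':X'\to X$ with $\mathsf p(f')=f$. $\mathsf p$ is hyperconnected if for every $X\in\mathbb E$ the map $\mathcal O(X)\to\{d\in\mathcal O(\mathsf p(X)): d\,\mathsf p(1_X)=d\}$, $e\mapsto\mathsf p(e)$, is an isomorphism. A latent hyperfibration is a hyperconnected latent fibration. A map $v:X\to Y$ of $\mathbb E$ is subvertical if $\mathsf p(v)$ is a restriction idempotent (so $\mathsf p(X)=\mathsf p(Y)$). A commuting square $f'b=af$ with $f':A'\to B'$, $b:B'\to B$, $a:A'\to A$, $f:A\to B$ is a latent pullback if $f'\overline b=f'$, $a\overline f=a$, and for all $x_0:X\to B'$, $x_1:X\to A$ and every restriction idempotent $e$ on $X$ with $ex_1f=ex_0b$, $e\le\overline{x_1f}$, $e\le\overline{x_0b}$, there is a unique $k:X\to A'$ with $\overline k=e$, $kf'\le x_0$, $ka\le x_1$ and $k\overline{f'}=k\overline a=k$. The fibrational dual of a latent hyperfibration $\mathsf p$: the restriction category $\mathbb E^*$ has the objects of $\mathbb E$; a map $X\to Y$ is an equivalence class $[(v,c)]$ of spans $X\xleftarrow{v}S\xrightarrow{c}Y$ in $\mathbb E$ with $v$ subvertical, $c$ $\mathsf p$-prone and $\overline v=\overline c$. Spans $(v,c)$ with apex $S$ and $(v',c')$ with apex $S'$ are equivalent if there is a subvertical partial isomorphism $\alpha:S\to S'$ with $\alpha v'=v$,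 $\alpha c'=c$, $\alpha^{(-1)}v=v'$, $\alpha^{(-1)}c=c'$, $\overline\alpha=\overline c$, $\overline{\alpha^{(-1)}}=\overline{c'}$. The identity is $[(1_X,1_X)]$. The composite of $[(v_1,c_1)]:X\to Y$ and $[(v_2,c_2)]:Y\to Z$ is $[(v_2^\ast v_1,c_1^\ast c_2)]$, where $(v_2^\ast,c_1^\ast)$ are the legs of a latent pullback of $c_1$ and $v_2$ with $v_2^\ast$ subvertical and $c_1^\ast$ prone (such latent pullbacks exist). The restriction is $\overline{[(v,c)]}=[(\widehat v,\widehat v)]$, where for $v:S\to X$ subvertical $\widehat v$ is the unique restriction idempotent on $X$ with $\mathsf p(\widehat v)=\mathsf p(v)$. The restriction semifunctor $\mathsf p^*:\mathbb E^*\to\mathbb B$ is $\mathsf p^*(A)=\mathsf p(A)$ on objects and $\mathsf p^*([(v,c)])=\mathsf p(c)$ on maps; $\mathsf p^*$ is again a latent hyperfibration, so the construction can be iterated. *)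

theory Defs
  imports Main
begin

text \<open>Composition is written in diagrammatic order throughout.\<close>

record ('o, 'm) rcat =
  Obj :: "'o set"
  Arr :: "'m set"
  Dom :: "'m \<Rightarrow> 'o"
  Cod :: "'m \<Rightarrow> 'o"
  Idm :: "'o \<Rightarrow> 'm"
  Comp :: "'m \<Rightarrow> 'm \<Rightarrow> 'm" (infixl "\<cdot>\<index>" 70)
  Rst :: "'m \<Rightarrow> 'm"

definition hom :: "('o, 'm) rcat \<Rightarrow> 'o \<Rightarrow> 'o \<Rightarrow> 'm set" where
  "hom C X Y = {f \<in> Arr C. Dom C f = X \<and> Cod C f = Y}"

locale restriction_category =
  fixes C :: "('o, 'm) rcat" (structure)
  assumes Dom_in: "f \<in> Arr C \<Longrightarrow> Dom C f \<in> Obj C"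
    and Cod_in: "f \<in> Arr C \<Longrightarrow> Cod C f \<in> Obj C"
    and Idm_in: "X \<in> Obj C \<Longrightarrow> Idm C X \<in> hom C X X"
    and Comp_in: "\<lbrakk>f \<in> hom C X Y; g \<in> hom C Y Z\<rbrakk> \<Longrightarrow> f \<cdot> g \<in> hom C X Z"
    and Comp_assoc:
      "\<lbrakk>f \<in> hom C W X; g \<in> hom C X Y; h \<in> hom C Y Z\<rbrakk> \<Longrightarrow> (f \<cdot> g) \<cdot> h = f \<cdot> (g \<cdot> h)"
    and Idm_left: "f \<in> hom C X Y \<Longrightarrow> Idm C X \<cdot> f = f"
    and Idm_right: "f \<in> hom C X Y \<Longrightarrow> f \<cdot> Idm C Y = f"
    and Rst_in: "f \<in> hom C X Y \<Longrightarrow> Rst C f \<in> hom C X X"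
    and R1: "f \<in> hom C X Y \<Longrightarrow> Rst C f \<cdot> f = f"
    and R2: "\<lbrakk>f \<in> hom C X Y; g \<in> hom C X Z\<rbrakk> \<Longrightarrow> Rst C f \<cdot> Rst C g = Rst C g \<cdot> Rst C f"
    and R3: "\<lbrakk>f \<in> hom C X Y; g \<in> hom C X Z\<rbrakk> \<Longrightarrow> Rst C (Rst C f \<cdot> g) = Rst C f \<cdot> Rst C g"
    and R4: "\<lbrakk>f \<in> hom C X Y; g \<in> hom C Y Z\<rbrakk> \<Longrightarrow> f \<cdot> Rst C g = Rst C (f \<cdot> g) \<cdot> f"

definition rst_idems :: "('o, 'm) rcat \<Rightarrow> 'o \<Rightarrow> 'm set" where
  "rst_idems C X = {e \<in> hom C X X. Rst C e = e}"

definition rle :: "('o, 'm) rcat \<Rightarrow> 'm \<Rightarrow> 'm \<Rightarrow> bool" where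
  "rle C f g \<longleftrightarrow> f \<in> Arr C \<and> g \<in> hom C (Dom C f) (Cod C f) \<and> Rst C f \<cdot>\<^bsub>C\<^esub> g = f"

definition partial_inverse :: "('o, 'm) rcat \<Rightarrow> 'm \<Rightarrow> 'm \<Rightarrow> bool" where
  "partial_inverse C s t \<longleftrightarrow>
     s \<in> Arr C \<and> t \<in> hom C (Cod C s) (Dom C s) \<and>
     s \<cdot>\<^bsub>C\<^esub> t = Rst C s \<and> t \<cdot>\<^bsub>C\<^esub> s = Rst C t"

text \<open>The triangle \<open>k f = g\<close> commutes and is precise.\<close>

definition precise_triangle :: "('o, 'm) rcat \<Rightarrow> 'm \<Rightarrow> 'm \<Rightarrow> 'm \<Rightarrow> bool" where
  "precise_triangle C k f g \<longleftrightarrow> k \<cdot>\<^bsub>C\<^esub> f = g \<and> Rst C g = Rst C k"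

text \<open>The square \<open>f' b = a f\<close> is a latent pullback.\<close>

definition latent_pullback :: "('o, 'm) rcat \<Rightarrow> 'm \<Rightarrow> 'm \<Rightarrow> 'm \<Rightarrow> 'm \<Rightarrow> bool" where
  "latent_pullback C f' b a f \<longleftrightarrow>
     f' \<in> Arr C \<and> b \<in> Arr C \<and> a \<in> Arr C \<and> f \<in> Arr C \<and>
     Cod C f' = Dom C b \<and> Dom C a = Dom C f' \<and> Cod C a = Dom C f \<and> Cod C f = Cod C b \<and>
     f' \<cdot>\<^bsub>C\<^esub> b = a \<cdot>\<^bsub>C\<^esub> f \<and>
     f' \<cdot>\<^bsub>C\<^esub> Rst C b = f' \<and> a \<cdot>\<^bsub>C\<^esub> Rst C f = a \<and>
     (\<forall>X\<in>Obj C. \<forall>x0\<in>hom C X (Dom C b). \<forall>x1\<in>hom C X (Dom C f). \<forall>e\<in>rst_idems C X.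
        e \<cdot>\<^bsub>C\<^esub> x1 \<cdot>\<^bsub>C\<^esub> f = e \<cdot>\<^bsub>C\<^esub> x0 \<cdot>\<^bsub>C\<^esub> b \<and>
        rle C e (Rst C (x1 \<cdot>\<^bsub>C\<^esub> f)) \<and> rle C e (Rst C (x0 \<cdot>\<^bsub>C\<^esub> b)) \<longrightarrow>
        (\<exists>!k. k \<in> hom C X (Dom C f') \<and> Rst C k = e \<and>
              rle C (k \<cdot>\<^bsub>C\<^esub> f') x0 \<and> rle C (k \<cdot>\<^bsub>C\<^esub> a) x1 \<and>
              k \<cdot>\<^bsub>C\<^esub> Rst C f' = k \<and> k \<cdot>\<^bsub>C\<^esub> Rst C a = k))"

record ('o, 'm, 'p, 'n) fmap =
  omap :: "'o \<Rightarrow> 'p"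
  amap :: "'m \<Rightarrow> 'n"

locale restriction_semifunctor =
  E: restriction_category E + B: restriction_category B
  for E :: "('o, 'm) rcat" and B :: "('p, 'n) rcat" and p :: "('o, 'm, 'p, 'n) fmap" +
  assumes omap_in: "X \<in> Obj E \<Longrightarrow> omap p X \<in> Obj B"
    and amap_in: "f \<in> hom E X Y \<Longrightarrow> amap p f \<in> hom B (omap p X) (omap p Y)"
    and amap_Comp:
      "\<lbrakk>f \<in> hom E X Y; g \<in> hom E Y Z\<rbrakk> \<Longrightarrow> amap p (f \<cdot>\<^bsub>E\<^esub> g) = amap p f \<cdot>\<^bsub>B\<^esub> amap p g"
    and amap_Rst: "f \<in> hom E X Y \<Longrightarrow> amap p (Rst E f) = Rst B (amap p f)"

locale restriction_functor = restriction_semifunctor +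
  assumes amap_Idm: "X \<in> Obj E \<Longrightarrow> amap p (Idm E X) = Idm B (omap p X)"

definition rcat_isomorphic :: "('o, 'm) rcat \<Rightarrow> ('p, 'n) rcat \<Rightarrow> bool" where
  "rcat_isomorphic C D \<longleftrightarrow>
     (\<exists>F G. restriction_functor C D F \<and> restriction_functor D C G \<and>
        (\<forall>X\<in>Obj C. omap G (omap F X) = X) \<and> (\<forall>f\<in>Arr C. amap G (amap F f) = f) \<and>
        (\<forall>Y\<in>Obj D. omap F (omap G Y) = Y) \<and> (\<forall>g\<in>Arr D. amap F (amap G g) = g))"

definition prone ::
  "('o, 'm) rcat \<Rightarrow> ('p, 'n) rcat \<Rightarrow> ('o, 'm, 'p, 'n) fmap \<Rightarrow> 'm \<Rightarrow> bool" where
  "prone E B p f' \<longleftrightarrow>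
     f' \<in> Arr E \<and>
     (\<forall>Y\<in>Obj E. \<forall>g\<in>hom E Y (Cod E f'). \<forall>h\<in>hom B (omap p Y) (omap p (Dom E f')).
        precise_triangle B h (amap p f') (amap p g) \<longrightarrow>
        (\<exists>!k. k \<in> hom E Y (Dom E f') \<and> amap p k = h \<and> precise_triangle E k f' g))"

definition subvertical ::
  "('o, 'm) rcat \<Rightarrow> ('p, 'n) rcat \<Rightarrow> ('o, 'm, 'p, 'n) fmap \<Rightarrow> 'm \<Rightarrow> bool" where
  "subvertical E B p v \<longleftrightarrow> v \<in> Arr E \<and> amap p v \<in> rst_idems B (omap p (Dom E v))"

locale latent_fibration = restriction_semifunctor +
  assumes prone_lift:
    "\<lbrakk>X \<in> Obj E; f \<in> hom B A (omap p X); f \<cdot>\<^bsub>B\<^esub> amap p (Idm E X) = f\<rbrakk>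
     \<Longrightarrow> \<exists>f'. prone E B p f' \<and> Cod E f' = X \<and> amap p f' = f"

text \<open>The map on restriction idempotents is an isomorphism of meet-semilattices (the meet being
  composition), i.e. an order isomorphism.\<close>

locale latent_hyperfibration = latent_fibration +
  assumes idems_bij:
    "X \<in> Obj E \<Longrightarrow>
       bij_betw (amap p) (rst_idems E X)
         {d \<in> rst_idems B (omap p X). d \<cdot>\<^bsub>B\<^esub> amap p (Idm E X) = d}"
    and idems_order:
    "\<lbrakk>X \<in> Obj E; e \<in> rst_idems E X; e' \<in> rst_idems E X\<rbrakk>
     \<Longrightarrow> rle E e e' \<longleftrightarrow> rle B (amap p e) (amap p e')"

text \<open>A span \<open>X \<leftarrow> S \<rightarrow> Y\<close> is the pair \<open>(v, c)\<close> of its legs, which determine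
  \<open>S\<close>, \<open>X\<close> and \<open>Y\<close>.\<close>

definition dual_spans ::
  "('o, 'm) rcat \<Rightarrow> ('p, 'n) rcat \<Rightarrow> ('o, 'm, 'p, 'n) fmap \<Rightarrow> ('m \<times> 'm) set" where
  "dual_spans E B p =
     {(v, c). subvertical E B p v \<and> prone E B p c \<and> Dom E v = Dom E c \<and> Rst E v = Rst E c}"

definition span_rel ::
  "('o, 'm) rcat \<Rightarrow> ('p, 'n) rcat \<Rightarrow> ('o, 'm, 'p, 'n) fmap \<Rightarrow> (('m \<times> 'm) \<times> ('m \<times> 'm)) set" where
  "span_rel E B p =
     {((v, c), (v', c')).
        (v, c) \<in> dual_spans E B p \<and> (v', c') \<in> dual_spans E B p \<and>
        Cod E v = Cod E v' \<and> Cod E c = Cod E c' \<and>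
        (\<exists>\<alpha> \<beta>. \<alpha> \<in> hom E (Dom E v) (Dom E v') \<and> subvertical E B p \<alpha> \<and>
           partial_inverse E \<alpha> \<beta> \<and>
           \<alpha> \<cdot>\<^bsub>E\<^esub> v' = v \<and> \<alpha> \<cdot>\<^bsub>E\<^esub> c' = c \<and> \<beta> \<cdot>\<^bsub>E\<^esub> v = v' \<and> \<beta> \<cdot>\<^bsub>E\<^esub> c = c' \<and>
           Rst E \<alpha> = Rst E c \<and> Rst E \<beta> = Rst E c')}"

definition span_class ::
  "('o, 'm) rcat \<Rightarrow> ('p, 'n) rcat \<Rightarrow> ('o, 'm, 'p, 'n) fmap \<Rightarrow> 'm \<Rightarrow> 'm \<Rightarrow> ('m \<times> 'm) set" where
  "span_class E B p v c = span_rel E B p `` {(v, c)}"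

definition hat ::
  "('o, 'm) rcat \<Rightarrow> ('o, 'm, 'p, 'n) fmap \<Rightarrow> 'm \<Rightarrow> 'm" where
  "hat E p v = (THE e. e \<in> rst_idems E (Cod E v) \<and> amap p e = amap p v)"

text \<open>Operations on classes are given by the value that is common to all choices of representatives
  (and, for the composite, of latent pullbacks).\<close>

definition fib_dual ::
  "('o, 'm) rcat \<Rightarrow> ('p, 'n) rcat \<Rightarrow> ('o, 'm, 'p, 'n) fmap \<Rightarrow> ('o, ('m \<times> 'm) set) rcat" where
  "fib_dual E B p =
     \<lparr>Obj = Obj E,
      Arr = {span_class E B p v c | v c. (v, c) \<in> dual_spans E B p},
      Dom = (\<lambda>s. THE X. \<exists>(v, c)\<in>s. X = Cod E v),
      Cod = (\<lambda>s. THE Y. \<exists>(v, c)\<in>s. Y = Cod E c),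
      Idm = (\<lambda>X. span_class E B p (Idm E X) (Idm E X)),
      Comp = (\<lambda>s1 s2. THE s. \<exists>(v1, c1)\<in>s1. \<exists>(v2, c2)\<in>s2. \<exists>v2' c1'.
                latent_pullback E c1' v2 v2' c1 \<and>
                subvertical E B p v2' \<and> prone E B p c1' \<and>
                s = span_class E B p (v2' \<cdot>\<^bsub>E\<^esub> v1) (c1' \<cdot>\<^bsub>E\<^esub> c2)),
      Rst = (\<lambda>s. THE r. \<exists>(v, c)\<in>s. r = span_class E B p (hat E p v) (hat E p v))\<rparr>"

definition fib_dual_proj ::
  "('o, 'm) rcat \<Rightarrow> ('p, 'n) rcat \<Rightarrow> ('o, 'm, 'p, 'n) fmap \<Rightarrow> ('o, ('m \<times> 'm) set, 'p, 'n) fmap" where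
  "fib_dual_proj E B p = \<lparr>omap = omap p, amap = (\<lambda>s. THE b. \<exists>(v, c)\<in>s. b = amap p c)\<rparr>"

end

theory Submission
  imports Defs
begin

text \<open>Every arrow \<open>f\<close> of a latent hyperfibration factors as \<open>f = v c\<close> with \<open>v\<close> subvertical, \<open>c\<close> prone
  and \<open>p(v)\<close> the restriction of \<open>p(c)\<close>, uniquely up to a comparison arrow between the prone parts.
  A prone \<open>c\<close> gives the prone arrow \<open>[(r(c), c)]\<close> of the dual, and a subvertical \<open>v : X \<rightarrow> S\<close> gives a
  subvertical arrow \<open>[(v, r(v))] : S \<rightarrow> X\<close> of the dual; every subvertical arrow of the dual is of
  this form, and every prone one is \<open>[(r(c), c)]\<close> up to a subvertical partial isomorphism. Hence the
  arrows of the double dual are exactly the classes of the spans formed by \<open>[(v, r(v))]\<close> and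
  \<open>[(r(c), c)]\<close>, and sending \<open>f = v c\<close> to this class is the isomorphism. The same construction applies
  to the dual because it is again a latent hyperfibration over the same base.\<close>

section \<open>Restriction categories and semifunctors\<close>

text \<open>Hyperconnectedness lets restrictions in \<open>E\<close> be compared in
  \<open>B\<close>. Preciseness of a triangle \<open>k \<cdot> c = g\<close> becomes the equation
  \<open>k \<cdot> R c = k\<close>, and most conditions become calculations in \<open>B\<close>,
  where subvertical arrows turn into idempotents that commute over a common object. Since
  \<open>p\<close> is only a semifunctor, \<open>P (Idm E X)\<close> need not be an identity, so
  lifting conditions have to carry it along. The obstacle is composition in the dual, which is
  defined through arbitrary latent pullbacks. The predicate \<open>dual_square\<close> trades the
  universal property for two equations in \<open>B\<close>, and pasting and independence of choices
  become equational. Once subvertical arrows are reversed, this equation is a dual square of the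
  dual, so composing factorizations in \<open>E\<close> is composing spans in the double
  dual.\<close>

context restriction_category
begin

lemma homI: "f \<in> Arr C \<Longrightarrow> f \<in> hom C (Dom C f) (Cod C f)"
  by (simp add: hom_def)

lemma Comp_Arr [simp]: "\<lbrakk>f \<in> Arr C; g \<in> Arr C; Cod C f = Dom C g\<rbrakk> \<Longrightarrow> f \<cdot> g \<in> Arr C"
  and Dom_Comp [simp]: "\<lbrakk>f \<in> Arr C; g \<in> Arr C; Cod C f = Dom C g\<rbrakk> \<Longrightarrow> Dom C (f \<cdot> g) = Dom C f"
  and Cod_Comp [simp]: "\<lbrakk>f \<in> Arr C; g \<in> Arr C; Cod C f = Dom C g\<rbrakk> \<Longrightarrow> Cod C (f \<cdot> g) = Cod C g"
  using Comp_in[of f "Dom C f" "Cod C f" g "Cod C g"] by (auto simp: hom_def)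

lemma Rst_Arr [simp]: "f \<in> Arr C \<Longrightarrow> Rst C f \<in> Arr C"
  and Dom_Rst [simp]: "f \<in> Arr C \<Longrightarrow> Dom C (Rst C f) = Dom C f"
  and Cod_Rst [simp]: "f \<in> Arr C \<Longrightarrow> Cod C (Rst C f) = Dom C f"
  using Rst_in[OF homI, of f] by (auto simp: hom_def)

lemma Idm_Arr [simp]: "X \<in> Obj C \<Longrightarrow> Idm C X \<in> Arr C"
  and Dom_Idm [simp]: "X \<in> Obj C \<Longrightarrow> Dom C (Idm C X) = X"
  and Cod_Idm [simp]: "X \<in> Obj C \<Longrightarrow> Cod C (Idm C X) = X"
  using Idm_in[of X] by (auto simp: hom_def)

declare Dom_in [simp] Cod_in [simp]

lemma assoc: "\<lbrakk>f \<in> Arr C; g \<in> Arr C; h \<in> Arr C; Cod C f = Dom C g; Cod C g = Dom C h\<rbrakk>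
    \<Longrightarrow> f \<cdot> g \<cdot> h = f \<cdot> (g \<cdot> h)"
  using Comp_assoc[of f "Dom C f" "Cod C f" g "Cod C g" h "Cod C h"] by (simp add: hom_def)

lemma Idm_Comp [simp]: "\<lbrakk>f \<in> Arr C; Dom C f = X\<rbrakk> \<Longrightarrow> Idm C X \<cdot> f = f"
  using Idm_left[OF homI, of f] by simp

lemma Comp_Idm [simp]: "\<lbrakk>f \<in> Arr C; Cod C f = X\<rbrakk> \<Longrightarrow> f \<cdot> Idm C X = f"
  using Idm_right[OF homI, of f] by simp

lemma Rst_Comp_self [simp]: "f \<in> Arr C \<Longrightarrow> Rst C f \<cdot> f = f"
  using R1[OF homI] .

lemma Rst_commute: "\<lbrakk>f \<in> Arr C; g \<in> Arr C; Dom C f = Dom C g\<rbrakk> \<Longrightarrow> Rst C f \<cdot> Rst C g = Rst C g \<cdot> Rst C f"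
  using R2[of f "Dom C f" "Cod C f" g "Cod C g"] by (simp add: hom_def)

lemma Rst_Rst_Comp: "\<lbrakk>f \<in> Arr C; g \<in> Arr C; Dom C f = Dom C g\<rbrakk> \<Longrightarrow> Rst C (Rst C f \<cdot> g) = Rst C f \<cdot> Rst C g"
  using R3[of f "Dom C f" "Cod C f" g "Cod C g"] by (simp add: hom_def)

lemma Comp_Rst: "\<lbrakk>f \<in> Arr C; g \<in> Arr C; Cod C f = Dom C g\<rbrakk> \<Longrightarrow> f \<cdot> Rst C g = Rst C (f \<cdot> g) \<cdot> f"
  using R4[of f "Dom C f" "Cod C f" g "Cod C g"] by (simp add: hom_def)

lemma Rst_Idm [simp]: "X \<in> Obj C \<Longrightarrow> Rst C (Idm C X) = Idm C X"
  using Rst_Comp_self[of "Idm C X"] by (simp del: Rst_Comp_self)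

lemma Rst_Rst [simp]: "f \<in> Arr C \<Longrightarrow> Rst C (Rst C f) = Rst C f"
  using Rst_Rst_Comp[of f "Idm C (Dom C f)"] by simp

lemma Rst_idem [simp]: "f \<in> Arr C \<Longrightarrow> Rst C f \<cdot> Rst C f = Rst C f"
  using Rst_Comp_self[of "Rst C f"] by (simp del: Rst_Comp_self)

lemma Rst_le_left: "\<lbrakk>f \<in> Arr C; g \<in> Arr C; Cod C f = Dom C g\<rbrakk> \<Longrightarrow> Rst C f \<cdot> Rst C (f \<cdot> g) = Rst C (f \<cdot> g)"
  using Rst_Rst_Comp[of f "f \<cdot> g"] by (simp add: assoc[symmetric])

lemma Rst_le_right: "\<lbrakk>f \<in> Arr C; g \<in> Arr C; Cod C f = Dom C g\<rbrakk> \<Longrightarrow> Rst C (f \<cdot> g) \<cdot> Rst C f = Rst C (f \<cdot> g)"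
  using Rst_le_left[of f g] Rst_commute[of f "f \<cdot> g"] by simp

lemma Rst_Comp_Rst [simp]:
  assumes "f \<in> Arr C" "g \<in> Arr C" "Cod C f = Dom C g"
  shows "Rst C (f \<cdot> Rst C g) = Rst C (f \<cdot> g)"
proof -
  have "Rst C (f \<cdot> Rst C g) = Rst C (Rst C (f \<cdot> g) \<cdot> f)"
    using assms by (simp only: Comp_Rst)
  also have "\<dots> = Rst C (f \<cdot> g)"
    using Rst_Rst_Comp[of "f \<cdot> g" f] assms by (simp add: Rst_le_right)
  finally show ?thesis .
qed

text \<open>By (R.4), \<open>f \<cdot> Rst C g\<close> is
  \<open>Rst C (f \<cdot> g) \<cdot> f\<close>. This turns preciseness of a triangle with left
  factor \<open>f\<close> into an equation that can be composed further, the form in which it is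
  mostly used below.\<close>

lemma Comp_Rst_eq_iff:
  assumes "f \<in> Arr C" "g \<in> Arr C" "Cod C f = Dom C g"
  shows "f \<cdot> Rst C g = f \<longleftrightarrow> Rst C (f \<cdot> g) = Rst C f"
  using assms Comp_Rst Rst_Comp_Rst Rst_Comp_self by metis

lemma Rst_mono_Comp:
  assumes "f \<in> Arr C" "g \<in> Arr C" "h \<in> Arr C" "Cod C f = Dom C g" "Dom C h = Dom C f"
    "Rst C h = Rst C (f \<cdot> g)"
  shows "Rst C f \<cdot> Rst C h = Rst C h" "Rst C h \<cdot> Rst C f = Rst C h"
  using assms by (simp_all add: Rst_le_left Rst_le_right)

lemma idem_Comp:
  assumes "e \<in> Arr C" "d \<in> Arr C" "Rst C e = e" "Rst C d = d" "Dom C d = Dom C e"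
  shows "e \<cdot> d = d \<cdot> e" "Rst C (e \<cdot> d) = e \<cdot> d"
  using Rst_commute[of e d] Rst_Rst_Comp[of e d] assms by simp_all

text \<open>Each of two partial inverses is a restriction of the other, and restrictions commute.
  The purpose is to find the image in \<open>B\<close> of the inverse of a subvertical partial
  isomorphism: a restriction idempotent is its own partial inverse.\<close>

lemma partial_inverse_unique:
  assumes "partial_inverse C s t" "partial_inverse C s t'"
  shows "t = t'"
proof -
  have ar: "s \<in> Arr C" "t \<in> Arr C" "t' \<in> Arr C" "Dom C t = Cod C s" "Cod C t = Dom C s"
      "Dom C t' = Cod C s" "Cod C t' = Dom C s"
    and st: "s \<cdot> t = Rst C s" "t \<cdot> s = Rst C t" "s \<cdot> t' = Rst C s" "t' \<cdot> s = Rst C t'"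
    using assms by (auto simp: partial_inverse_def hom_def)
  have 1: "Rst C t \<cdot> t' = t"
    using assoc[of t s t'] assoc[of t s t] ar st by simp
  have 2: "Rst C t' \<cdot> t = t'"
    using assoc[of t' s t] assoc[of t' s t'] ar st by simp
  have "t = Rst C t \<cdot> (Rst C t' \<cdot> t)"
    using 1 2 by simp
  also have "\<dots> = Rst C t' \<cdot> t"
    using ar Rst_commute[of t t'] assoc[of "Rst C t" "Rst C t'" t] assoc[of "Rst C t'" "Rst C t" t] by simp
  finally show ?thesis using 2 by simp
qed

end

context restriction_semifunctor
begin

lemma amap_Arr [simp]: "f \<in> Arr E \<Longrightarrow> amap p f \<in> Arr B"
  and Dom_amap [simp]: "f \<in> Arr E \<Longrightarrow> Dom B (amap p f) = omap p (Dom E f)"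
  and Cod_amap [simp]: "f \<in> Arr E \<Longrightarrow> Cod B (amap p f) = omap p (Cod E f)"
  using amap_in[OF E.homI, of f] by (auto simp: hom_def)

lemma amap_Comp' [simp]: "\<lbrakk>f \<in> Arr E; g \<in> Arr E; Cod E f = Dom E g\<rbrakk>
    \<Longrightarrow> amap p (f \<cdot>\<^bsub>E\<^esub> g) = amap p f \<cdot>\<^bsub>B\<^esub> amap p g"
  using amap_Comp[of f "Dom E f" "Cod E f" g "Cod E g"] by (simp add: hom_def)

lemma amap_Rst' [simp]: "f \<in> Arr E \<Longrightarrow> amap p (Rst E f) = Rst B (amap p f)"
  using amap_Rst[OF E.homI] .

declare omap_in [simp]

end

section \<open>Prone and subvertical arrows\<close>

locale hyperfib = latent_hyperfibration E B p
  for E :: "('o, 'm) rcat" (structure) and B :: "('p, 'n) rcat" and p :: "('o, 'm, 'p, 'n) fmap"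
begin

abbreviation "P \<equiv> amap p"
abbreviation "R \<equiv> Rst E"
abbreviation "RB \<equiv> Rst B"
abbreviation "sub \<equiv> subvertical E B p"
abbreviation "pr \<equiv> prone E B p"

lemma sub_Arr [simp]: "sub v \<Longrightarrow> v \<in> Arr E"
  and sub_Rst: "sub v \<Longrightarrow> RB (P v) = P v"
  and sub_omap: "sub v \<Longrightarrow> omap p (Cod E v) = omap p (Dom E v)"
  unfolding subvertical_def rst_idems_def hom_def
  by (auto dest: Cod_amap)

text \<open>A restriction has equal domain and codomain, so the equation alone forces
  \<open>P v\<close> to be an endomap; no object condition is left to check.\<close>

lemma sub_iff: "sub v \<longleftrightarrow> v \<in> Arr E \<and> RB (P v) = P v"
proof
  assume v: "v \<in> Arr E \<and> RB (P v) = P v"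
  then have "omap p (Cod E v) = omap p (Dom E v)"
    by (metis B.Cod_Rst Cod_amap Dom_amap amap_Arr)
  with v show "sub v" by (simp add: subvertical_def rst_idems_def hom_def del: sub_Arr)
qed (simp add: sub_Rst)

lemma sub_idem: "sub v \<Longrightarrow> P v \<cdot>\<^bsub>B\<^esub> P v = P v"
  using B.Rst_idem[of "P v"] by (simp add: sub_Rst)

lemma sub_R [simp]: "f \<in> Arr E \<Longrightarrow> sub (R f)"
  by (simp add: sub_iff)

lemma pr_Arr [simp]: "pr c \<Longrightarrow> c \<in> Arr E"
  by (simp add: prone_def)

text \<open>The injectivity half of hyperconnectedness, applied to the idempotents
  \<open>R f\<close> and \<open>R g\<close>. It moves comparisons of restrictions from
  \<open>E\<close> to \<open>B\<close>.\<close>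

lemma R_reflect:
  assumes "f \<in> Arr E" "g \<in> Arr E" "Dom E f = Dom E g" "RB (P f) = RB (P g)"
  shows "R f = R g"
proof -
  have "inj_on P (rst_idems E (Dom E f))"
    using idems_bij[of "Dom E f"] assms by (simp add: bij_betw_def)
  moreover have "R f \<in> rst_idems E (Dom E f)" "R g \<in> rst_idems E (Dom E f)"
    using assms by (auto simp: rst_idems_def hom_def)
  ultimately show ?thesis
    using assms inj_onD[of P "rst_idems E (Dom E f)" "R f" "R g"] by simp
qed

text \<open>The surjectivity half of hyperconnectedness. Only idempotents below
  \<open>P (Idm E X)\<close> can be hit, because \<open>p\<close> need not preserve
  identities.\<close>

lemma idem_over:
  assumes "X \<in> Obj E" "d \<in> Arr B" "Dom B d = omap p X" "RB d = d" "d \<cdot>\<^bsub>B\<^esub> P (Idm E X) = d"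
  obtains e where "e \<in> Arr E" "Dom E e = X" "Cod E e = X" "R e = e" "P e = d"
proof -
  have "Cod B d = omap p X" using assms B.Cod_Rst[of d] by simp
  then have "d \<in> P ` rst_idems E X"
    using idems_bij[OF assms(1)] assms by (simp add: bij_betw_def rst_idems_def hom_def)
  then show ?thesis using that by (auto simp: rst_idems_def hom_def)
qed

lemma P_Idm_right [simp]: "\<lbrakk>f \<in> Arr E; X = Cod E f\<rbrakk> \<Longrightarrow> P f \<cdot>\<^bsub>B\<^esub> P (Idm E X) = P f"
  using amap_Comp'[of f "Idm E (Cod E f)"] by simp

lemma precise_reflect:
  assumes "k \<in> Arr E" "c \<in> Arr E" "Cod E k = Dom E c" "k \<cdot> c = g" "RB (P g) = RB (P k)"
  shows "precise_triangle E k c g"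
  using assms R_reflect[of g k] by (auto simp: precise_triangle_def)

lemma pr_lift:
  assumes "pr c" "g \<in> Arr E" "Cod E g = Cod E c" "h \<in> Arr B" "Dom B h = omap p (Dom E g)"
    "Cod B h = omap p (Dom E c)" "h \<cdot>\<^bsub>B\<^esub> P c = P g" "RB h = RB (P g)"
  obtains k where "k \<in> Arr E" "Dom E k = Dom E g" "Cod E k = Dom E c" "P k = h" "k \<cdot> c = g"
proof -
  have "g \<in> hom E (Dom E g) (Cod E c)" "h \<in> hom B (omap p (Dom E g)) (omap p (Dom E c))"
    "Dom E g \<in> Obj E" "precise_triangle B h (P c) (P g)"
    using assms by (auto simp: hom_def precise_triangle_def)
  then have "\<exists>!k. k \<in> hom E (Dom E g) (Dom E c) \<and> P k = h \<and> precise_triangle E k c g"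
    using assms(1) unfolding prone_def by blast
  then show ?thesis using that by (auto simp: precise_triangle_def hom_def)
qed

text \<open>Totality of \<open>k\<close> over \<open>c\<close> makes its triangle precise; the
  triangle of \<open>k'\<close> is then precise too, since preciseness is decided in
  \<open>B\<close>, where the two images agree. This cancellation against a prone arrow proves most
  equations between lifts below.\<close>

lemma pr_unique:
  assumes c: "pr c" and k: "k \<in> Arr E" "Cod E k = Dom E c" and k': "k' \<in> Arr E" "Cod E k' = Dom E c"
    and eq: "k \<cdot> c = k' \<cdot> c" "P k = P k'" and tot: "k \<cdot> R c = k"
  shows "k = k'"
proof -
  have ca: "c \<in> Arr E" using c by simp
  have D: "Dom E k' = Dom E k"
    using eq(1) k k' ca by (metis E.Dom_Comp)
  have R: "RB (P (k \<cdot> c)) = RB (P k)"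
    using tot k ca by (metis E.Comp_Rst_eq_iff amap_Rst' E.Comp_Arr)
  let ?g = "k \<cdot> c"
  have "?g \<in> hom E (Dom E k) (Cod E c)" "P k \<in> hom B (omap p (Dom E k)) (omap p (Dom E c))"
    "Dom E k \<in> Obj E" "precise_triangle B (P k) (P c) (P ?g)"
    using k ca R by (simp_all add: hom_def precise_triangle_def)
  then have "\<exists>!x. x \<in> hom E (Dom E k) (Dom E c) \<and> P x = P k \<and> precise_triangle E x c ?g"
    using c unfolding prone_def by blast
  moreover have "k \<in> hom E (Dom E k) (Dom E c) \<and> P k = P k \<and> precise_triangle E k c ?g"
    using k ca R by (simp add: precise_reflect hom_def)
  moreover have "k' \<in> hom E (Dom E k) (Dom E c) \<and> P k' = P k \<and> precise_triangle E k' c ?g"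
    using k' k ca R eq D by (simp add: precise_reflect hom_def)
  ultimately show ?thesis by blast
qed

text \<open>Preciseness of a filler is reflected from \<open>B\<close>, so existence only asks for a
  filler over \<open>h\<close>, while in the uniqueness part both fillers may be taken total over
  \<open>c\<close>.\<close>

lemma prI:
  assumes c: "c \<in> Arr E"
    and ex: "\<And>g h. \<lbrakk>g \<in> Arr E; Cod E g = Cod E c; h \<in> Arr B; Dom B h = omap p (Dom E g);
      Cod B h = omap p (Dom E c); h \<cdot>\<^bsub>B\<^esub> P c = P g; RB h = RB (P g)\<rbrakk>
      \<Longrightarrow> \<exists>k. k \<in> Arr E \<and> Dom E k = Dom E g \<and> Cod E k = Dom E c \<and> P k = h \<and> k \<cdot> c = g"
    and un: "\<And>k k'. \<lbrakk>k \<in> Arr E; Cod E k = Dom E c; k' \<in> Arr E; Cod E k' = Dom E c; Dom E k' = Dom E k;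
      k \<cdot> c = k' \<cdot> c; P k = P k'; k \<cdot> R c = k; k' \<cdot> R c = k'\<rbrakk> \<Longrightarrow> k = k'"
  shows "pr c"
  unfolding prone_def
proof (intro conjI ballI impI c)
  fix Y g h
  assume "Y \<in> Obj E" and g: "g \<in> hom E Y (Cod E c)" and h: "h \<in> hom B (omap p Y) (omap p (Dom E c))"
    and pt: "precise_triangle B h (P c) (P g)"
  obtain k where k: "k \<in> Arr E" "Dom E k = Y" "Cod E k = Dom E c" "P k = h" "k \<cdot> c = g"
    using ex[of g h] g h pt by (auto simp: hom_def precise_triangle_def)
  show "\<exists>!k. k \<in> hom E Y (Dom E c) \<and> P k = h \<and> precise_triangle E k c g"
  proof (rule ex1I[of _ k])
    show "k \<in> hom E Y (Dom E c) \<and> P k = h \<and> precise_triangle E k c g"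
      using k c pt by (auto simp: hom_def precise_triangle_def intro: R_reflect)
    fix k'
    assume k': "k' \<in> hom E Y (Dom E c) \<and> P k' = h \<and> precise_triangle E k' c g"
    have "R g = R k" using k c pt by (auto simp: precise_triangle_def intro: R_reflect)
    moreover have "k' \<in> Arr E" "Dom E k' = Y" "Cod E k' = Dom E c" "P k' = h" "k' \<cdot> c = g" "R g = R k'"
      using k' by (auto simp: hom_def precise_triangle_def)
    moreover have "k \<cdot> R c = k" "k' \<cdot> R c = k'"
      using E.Comp_Rst_eq_iff[of k c] E.Comp_Rst_eq_iff[of k' c] k c calculation by simp_all
    ultimately show "k' = k"
      using k by - (rule un, simp_all)
  qed
qed

section \<open>Construction, composition and cancellation of prone arrows\<close>

lemma pr_lift_of:
  assumes "X \<in> Obj E" "f \<in> Arr B" "Cod B f = omap p X" "f \<cdot>\<^bsub>B\<^esub> P (Idm E X) = f"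
  obtains c where "pr c" "Cod E c = X" "P c = f" "omap p (Dom E c) = Dom B f"
proof -
  obtain c where c: "pr c" "Cod E c = X" "P c = f"
    using prone_lift[OF assms(1), of f "Dom B f"] assms by (auto simp: hom_def)
  moreover have "omap p (Dom E c) = Dom B f"
    using Dom_amap[of c] c by simp
  ultimately show ?thesis using that by blast
qed

lemma pr_Comp:
  assumes c: "pr c" and d: "pr d" and [simp]: "Cod E c = Dom E d"
  shows "pr (c \<cdot> d)"
proof -
  have [simp]: "c \<in> Arr E" "d \<in> Arr E" using c d by simp_all
  show ?thesis
  proof (rule prI)
    fix g h
    assume g: "g \<in> Arr E" "Cod E g = Cod E (c \<cdot> d)" and h: "h \<in> Arr B" "Dom B h = omap p (Dom E g)"
      "Cod B h = omap p (Dom E (c \<cdot> d))" and eq: "h \<cdot>\<^bsub>B\<^esub> P (c \<cdot> d) = P g" and R: "RB h = RB (P g)"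
    \<comment> \<open>Restrictions shrink along composites. That of \<open>h\<close> followed by
      \<open>P c\<close> lies between that of \<open>P g\<close> and that of \<open>h\<close>, which
      coincide; so both stages of the lift, along \<open>d\<close> and then along \<open>c\<close>,
      are precise.\<close>
    have 1: "RB (h \<cdot>\<^bsub>B\<^esub> P c) = RB h"
      using B.Rst_mono_Comp(1)[of "h \<cdot>\<^bsub>B\<^esub> P c" "P d" h] B.Rst_le_right[of h "P c"]
        B.Rst_commute[of h "h \<cdot>\<^bsub>B\<^esub> P c"] g h eq R
      by (simp add: B.assoc)
    obtain k where k: "k \<in> Arr E" "Dom E k = Dom E g" "Cod E k = Dom E d" "P k = h \<cdot>\<^bsub>B\<^esub> P c" "k \<cdot> d = g"
      by (rule pr_lift[OF d, of g "h \<cdot>\<^bsub>B\<^esub> P c"]) (use g h eq R 1 in \<open>simp_all add: B.assoc\<close>)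
    obtain l where l: "l \<in> Arr E" "Dom E l = Dom E k" "Cod E l = Dom E c" "P l = h" "l \<cdot> c = k"
      by (rule pr_lift[OF c, of k h]) (use h k 1 in simp_all)
    have "l \<cdot> (c \<cdot> d) = g" using k l by (simp add: E.assoc[symmetric])
    then show "\<exists>k. k \<in> Arr E \<and> Dom E k = Dom E g \<and> Cod E k = Dom E (c \<cdot> d) \<and> P k = h \<and> k \<cdot> (c \<cdot> d) = g"
      using k l by auto
  next
    fix k k'
    assume k: "k \<in> Arr E" "Cod E k = Dom E (c \<cdot> d)" "k' \<in> Arr E" "Cod E k' = Dom E (c \<cdot> d)"
      and eq: "k \<cdot> (c \<cdot> d) = k' \<cdot> (c \<cdot> d)" "P k = P k'" and tot: "k \<cdot> R (c \<cdot> d) = k"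
    have 1: "k \<cdot> R c = k"
      using k tot by (metis E.Rst_le_right E.assoc E.Rst_Arr E.Dom_Rst E.Cod_Rst E.Comp_Arr E.Dom_Comp \<open>c \<in> Arr E\<close> \<open>d \<in> Arr E\<close> \<open>Cod E c = Dom E d\<close>)
    have 2: "k \<cdot> c \<cdot> R d = k \<cdot> c"
      using k tot by (simp add: E.assoc E.Comp_Rst) (simp add: E.assoc[symmetric])
    have "k \<cdot> c = k' \<cdot> c"
      by (rule pr_unique[OF d]) (use k eq 2 in \<open>simp_all add: E.assoc\<close>)
    then show "k = k'"
      using k eq 1 by - (rule pr_unique[OF c], simp_all)
  qed simp
qed

text \<open>To factor \<open>g\<close> through \<open>b\<close>, factor \<open>g \<cdot> c\<close>
  through the prone \<open>b \<cdot> c\<close> and cancel \<open>c\<close>. Totality of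
  \<open>b\<close> over \<open>c\<close> ensures that composing with \<open>c\<close> loses no part
  of the domain of \<open>g\<close>.\<close>

lemma pr_cancel:
  assumes c: "pr c" and b: "b \<in> Arr E" and bc: "Cod E b = Dom E c" and d: "pr (b \<cdot> c)" and tot: "b \<cdot> R c = b"
  shows "pr b"
proof -
  have [simp]: "c \<in> Arr E" using c by simp
  note [simp] = b bc
  have totB: "P b \<cdot>\<^bsub>B\<^esub> RB (P c) = P b"
    using tot amap_Comp'[of b "R c"] by simp
  show ?thesis
  proof (rule prI)
    fix g h
    assume g: "g \<in> Arr E" "Cod E g = Cod E b" and h: "h \<in> Arr B" "Dom B h = omap p (Dom E g)"
      "Cod B h = omap p (Dom E b)" and eq: "h \<cdot>\<^bsub>B\<^esub> P b = P g" and R: "RB h = RB (P g)"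
    have 0: "P g \<cdot>\<^bsub>B\<^esub> RB (P c) = P g"
      using eq[symmetric] totB h g by (simp add: B.assoc)
    then have 1: "RB (P (g \<cdot> c)) = RB h"
      using B.Comp_Rst_eq_iff[of "P g" "P c"] R g by simp
    obtain k where k: "k \<in> Arr E" "Dom E k = Dom E g" "Cod E k = Dom E b" "P k = h" "k \<cdot> (b \<cdot> c) = g \<cdot> c"
      by (rule pr_lift[OF d, of "g \<cdot> c" h]) (use g h eq 1 in \<open>simp_all add: B.assoc[symmetric]\<close>)
    have "R (g \<cdot> c) = R g" using 1 R g by (intro R_reflect) auto
    then have "g = k \<cdot> b"
      using k g h eq by - (rule pr_unique[OF c], simp_all add: E.assoc E.Comp_Rst_eq_iff)
    then show "\<exists>k. k \<in> Arr E \<and> Dom E k = Dom E g \<and> Cod E k = Dom E b \<and> P k = h \<and> k \<cdot> b = g"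
      using k by blast
  next
    fix k k'
    assume k: "k \<in> Arr E" "Cod E k = Dom E b" "k' \<in> Arr E" "Cod E k' = Dom E b"
      and eq: "k \<cdot> b = k' \<cdot> b" "P k = P k'" and t: "k \<cdot> R b = k"
    have "R (b \<cdot> c) = R b" using tot by (simp add: E.Comp_Rst_eq_iff)
    then show "k = k'"
      using k eq t by - (rule pr_unique[OF d], simp_all add: E.assoc[symmetric])
  qed simp
qed

text \<open>A precise triangle over \<open>P e\<close> forces \<open>h = P g\<close>, so that
  \<open>g\<close> already absorbs \<open>e\<close> and is its own filler.\<close>

lemma pr_R:
  assumes e: "e \<in> Arr E" "R e = e"
  shows "pr e"
proof -
  have [simp]: "Cod E e = Dom E e" using e E.Cod_Rst[of e] by simp
  have eB: "RB (P e) = P e" using e amap_Rst'[of e] by simp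
  show ?thesis
  proof (rule prI)
    fix g h
    assume g: "g \<in> Arr E" "Cod E g = Cod E e" and h: "h \<in> Arr B" "Dom B h = omap p (Dom E g)"
      "Cod B h = omap p (Dom E e)" and eq: "h \<cdot>\<^bsub>B\<^esub> P e = P g" and R: "RB h = RB (P g)"
    have "h \<cdot>\<^bsub>B\<^esub> RB (P e) = h"
      using B.Comp_Rst_eq_iff[of h "P e"] h eq R e by simp
    then have hg: "P g = h" using eq eB by simp
    have "P g \<cdot>\<^bsub>B\<^esub> P e = P g" using eq hg by simp
    then have "R (g \<cdot> e) = R g" using g e by (intro R_reflect) auto
    then have "g \<cdot> R e = g" using g e E.Comp_Rst_eq_iff[of g e] by simp
    then show "\<exists>k. k \<in> Arr E \<and> Dom E k = Dom E g \<and> Cod E k = Dom E e \<and> P k = h \<and> k \<cdot> e = g"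
      using g e hg by auto
  qed (use e in auto)
qed

text \<open>The hypothesis \<open>eq\<close> says \<open>P f \<le> P c\<close>, so the triangle with
  left factor \<open>RB (P f)\<close> is precise. Its filler along the prone \<open>c\<close> is
  subvertical because it lies over a restriction; the subvertical comparison arrows below come from
  here.\<close>

lemma subvertical_lift:
  assumes c: "pr c" and f: "f \<in> Arr E" "Cod E f = Cod E c" "omap p (Dom E f) = omap p (Dom E c)"
    and eq: "RB (P f) \<cdot>\<^bsub>B\<^esub> P c = P f"
  obtains v where "sub v" "Dom E v = Dom E f" "Cod E v = Dom E c" "P v = RB (P f)" "v \<cdot> c = f"
    "R v = R f" "v \<cdot> R c = v"
proof -
  have [simp]: "c \<in> Arr E" using c by simp
  obtain v where v: "v \<in> Arr E" "Dom E v = Dom E f" "Cod E v = Dom E c" "P v = RB (P f)" "v \<cdot> c = f"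
    by (rule pr_lift[OF c, of f "RB (P f)"]) (use f eq in simp_all)
  have "R v = R f" using v f by (intro R_reflect) auto
  moreover have "v \<cdot> R c = v" using v calculation E.Comp_Rst_eq_iff[of v c] by simp
  moreover have "sub v" using v f by (simp add: sub_iff)
  ultimately show ?thesis using that v by blast
qed

text \<open>The prone factor is a lift of the whole of \<open>P f\<close>; what remains of
  \<open>f\<close> is its filler over the restriction of \<open>P f\<close>.\<close>

lemma factorize:
  assumes f: "f \<in> Arr E"
  obtains v c where "sub v" "pr c" "Dom E v = Dom E f" "Cod E v = Dom E c" "Cod E c = Cod E f"
    "v \<cdot> c = f" "P v = RB (P c)" "P c = P f"
proof -
  obtain c where c: "pr c" "Cod E c = Cod E f" "P c = P f" "omap p (Dom E c) = omap p (Dom E f)"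
    using pr_lift_of[of "Cod E f" "P f"] f by (metis Cod_amap Dom_amap E.Cod_in P_Idm_right amap_Arr)
  obtain v where "sub v" "Dom E v = Dom E f" "Cod E v = Dom E c" "P v = RB (P f)" "v \<cdot> c = f"
    by (rule subvertical_lift[OF c(1), of f]) (use c f in auto)
  with c that show ?thesis by metis
qed

section \<open>Latent pullbacks of prone and subvertical arrows\<close>

lemma subI: "\<lbrakk>v \<in> Arr E; RB (P v) = P v\<rbrakk> \<Longrightarrow> sub v"
  by (simp add: sub_iff)

text \<open>\<open>P v\<close> equals \<open>P (R v)\<close>, and \<open>R v\<close> ends where
  \<open>v\<close> starts. Hence a base arrow that ends with \<open>P v\<close> satisfies the
  lifting condition at \<open>Dom E v\<close>.\<close>

lemma P_sub_Idm: "sub v \<Longrightarrow> P v \<cdot>\<^bsub>B\<^esub> P (Idm E (Dom E v)) = P v"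
  using amap_Comp'[of "R v" "Idm E (Dom E v)"] by (simp add: sub_Rst)

text \<open>Lemma \<open>dual_square_iff\<close> shows that these are the latent pullbacks used in the composition of the
  dual; the conditions on \<open>P m\<close> and \<open>P u\<close> replace the universal property.\<close>

definition dual_square :: "'m \<Rightarrow> 'm \<Rightarrow> 'm \<Rightarrow> 'm \<Rightarrow> bool" where
  "dual_square m v u c \<longleftrightarrow> pr m \<and> sub v \<and> u \<in> Arr E \<and> pr c \<and> Cod E m = Dom E v \<and> Cod E u = Dom E c \<and>
     Dom E m = Dom E u \<and> Cod E v = Cod E c \<and> m \<cdot> v = u \<cdot> c \<and> P m = P c \<cdot>\<^bsub>B\<^esub> P v \<and> P u = RB (P m)"

lemma dual_squareD:
  assumes "dual_square m v u c"
  shows "pr m" "sub v" "u \<in> Arr E" "pr c" "Cod E m = Dom E v" "Cod E u = Dom E c"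
    "Dom E m = Dom E u" "Cod E v = Cod E c" "m \<cdot> v = u \<cdot> c" "P m = P c \<cdot>\<^bsub>B\<^esub> P v" "P u = RB (P m)"
  using assms by (auto simp: dual_square_def)

lemma dual_square_facts:
  assumes "dual_square m v u c"
  shows "sub u" "P m \<cdot>\<^bsub>B\<^esub> P v = P m" "R m = R u" "m \<cdot> R v = m" "u \<cdot> R c = u"
    "RB (P m) \<cdot>\<^bsub>B\<^esub> RB (P c) = RB (P m)" "RB (P m) \<cdot>\<^bsub>B\<^esub> P c = P m"
proof -
  note g = dual_squareD[OF assms]
  have [simp]: "m \<in> Arr E" "c \<in> Arr E" "v \<in> Arr E" using g by simp_all
  have ov: "omap p (Cod E c) = omap p (Dom E v)" using g sub_omap[of v] by simp
  show "sub u" using g(3,11) by (intro subI) simp_all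
  show mv: "P m \<cdot>\<^bsub>B\<^esub> P v = P m"
    using g ov by (simp add: B.assoc sub_idem)
  show mu: "R m = R u" using g(3,7,11) \<open>m \<in> Arr E\<close> by (intro R_reflect) simp_all
  have 1: "R (m \<cdot> v) = R m" using g(5) mv by (intro R_reflect) simp_all
  then show "m \<cdot> R v = m" using g E.Comp_Rst_eq_iff[of m v] by simp
  show "u \<cdot> R c = u" using g 1 mu E.Comp_Rst_eq_iff[of u c] by simp
  show "RB (P m) \<cdot>\<^bsub>B\<^esub> RB (P c) = RB (P m)"
    using g B.Rst_le_right[of "P c" "P v"] ov by simp
  show "RB (P m) \<cdot>\<^bsub>B\<^esub> P c = P m"
    using g B.Comp_Rst[of "P c" "P v"] ov by (simp add: sub_Rst)
qed

text \<open>Take for \<open>m\<close> a prone lift of \<open>P c\<close> followed by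
  \<open>P v\<close>. Then \<open>m \<cdot> v\<close> has the same image as \<open>m\<close>, and by
  (R.4) this image is a restriction of \<open>P c\<close>, so \<open>m \<cdot> v\<close> factors
  through \<open>c\<close> by a subvertical \<open>u\<close>.\<close>

lemma dual_square_exists:
  assumes c: "pr c" and v: "sub v" and [simp]: "Cod E v = Cod E c"
  obtains m u where "dual_square m v u c"
proof -
  have [simp]: "c \<in> Arr E" "v \<in> Arr E" using c v by simp_all
  have ov: "omap p (Cod E c) = omap p (Dom E v)" using sub_omap[OF v] by simp
  obtain m where m: "pr m" "Cod E m = Dom E v" "P m = P c \<cdot>\<^bsub>B\<^esub> P v" "omap p (Dom E m) = omap p (Dom E c)"
    by (rule pr_lift_of[of "Dom E v" "P c \<cdot>\<^bsub>B\<^esub> P v"]) (use v ov in \<open>simp_all add: B.assoc P_sub_Idm\<close>)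
  have mv: "P (m \<cdot> v) = P m" using m v ov by (simp add: B.assoc sub_idem)
  obtain u where u: "sub u" "Dom E u = Dom E (m \<cdot> v)" "Cod E u = Dom E c" "P u = RB (P (m \<cdot> v))"
      "u \<cdot> c = m \<cdot> v"
  proof (rule subvertical_lift[OF c, of "m \<cdot> v"])
    show "RB (P (m \<cdot> v)) \<cdot>\<^bsub>B\<^esub> P c = P (m \<cdot> v)"
      unfolding mv m(3) using B.Comp_Rst[of "P c" "P v"] ov v by (simp add: sub_Rst)
  qed (use m ov in simp_all)
  have "dual_square m v u c" unfolding dual_square_def using m u mv c v by simp
  then show ?thesis using that by blast
qed

text \<open>Since \<open>P u\<close> is the restriction of \<open>P m\<close>, the mediating arrow
  of a cone has to lie over \<open>P (e \<cdot> x1)\<close>. It is obtained by lifting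
  \<open>e \<cdot> x0\<close> along the prone \<open>m\<close>; its triangle with \<open>u\<close>
  follows by cancelling the prone \<open>c\<close>.\<close>

lemma latent_pullback_if_dual_square:
  assumes "dual_square m v u c"
  shows "latent_pullback E m v u c"
proof -
  note g = dual_squareD[OF assms] dual_square_facts[OF assms]
  have [simp]: "m \<in> Arr E" "c \<in> Arr E" "v \<in> Arr E" "u \<in> Arr E" using g by simp_all
  note [simp] = g(5-8)
  have ov: "omap p (Cod E c) = omap p (Dom E v)" using g sub_omap[of v] by simp
  have oc: "omap p (Dom E u) = omap p (Dom E c)" using g sub_omap[of u] by simp
  have ex: "\<exists>!k. k \<in> hom E X (Dom E m) \<and> R k = e \<and> rle E (k \<cdot> m) x0 \<and> rle E (k \<cdot> u) x1 \<and>
      k \<cdot> R m = k \<and> k \<cdot> R u = k"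
    if x: "x0 \<in> hom E X (Dom E v)" "x1 \<in> hom E X (Dom E c)" "e \<in> rst_idems E X"
      and H: "e \<cdot> x1 \<cdot> c = e \<cdot> x0 \<cdot> v" "rle E e (R (x1 \<cdot> c))" "rle E e (R (x0 \<cdot> v))" for X x0 x1 e
  proof -
    have [simp]: "x0 \<in> Arr E" "Dom E x0 = X" "Cod E x0 = Dom E v" "x1 \<in> Arr E" "Dom E x1 = X"
        "Cod E x1 = Dom E c" "e \<in> Arr E" "Dom E e = X" "Cod E e = X" "R e = e"
      using x by (auto simp: hom_def rst_idems_def)
    have e1: "e \<cdot> R (x1 \<cdot> c) = e" and e0: "e \<cdot> R (x0 \<cdot> v) = e"
      using H(2,3) by (auto simp: rle_def)
    have e0': "e \<cdot> R x0 = e"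
      using e0 E.Rst_le_right[of x0 v] by (metis E.assoc E.Rst_Arr E.Dom_Rst E.Cod_Rst E.Comp_Arr E.Dom_Comp
        \<open>x0 \<in> Arr E\<close> \<open>v \<in> Arr E\<close> \<open>Cod E x0 = Dom E v\<close> \<open>e \<in> Arr E\<close> \<open>Cod E e = X\<close> \<open>Dom E x0 = X\<close>)
    have e1': "e \<cdot> R x1 = e"
      using e1 E.Rst_le_right[of x1 c] by (metis E.assoc E.Rst_Arr E.Dom_Rst E.Cod_Rst E.Comp_Arr E.Dom_Comp
        \<open>x1 \<in> Arr E\<close> \<open>c \<in> Arr E\<close> \<open>Cod E x1 = Dom E c\<close> \<open>e \<in> Arr E\<close> \<open>Cod E e = X\<close> \<open>Dom E x1 = X\<close>)
    have R0: "R (e \<cdot> x0) = e" using E.Rst_Rst_Comp[of e x0] e0' by simp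
    have R1: "R (e \<cdot> x1) = e" using E.Rst_Rst_Comp[of e x1] e1' by simp
    have x0v: "e \<cdot> x0 \<cdot> R v = e \<cdot> x0"
      using E.Comp_Rst[of x0 v] e0 E.assoc[of e "R (x0 \<cdot> v)" x0] E.assoc[of e x0 "R v"] by simp
    have x1c: "e \<cdot> x1 \<cdot> R c = e \<cdot> x1"
      using E.Comp_Rst[of x1 c] e1 E.assoc[of e "R (x1 \<cdot> c)" x1] E.assoc[of e x1 "R c"] by simp
    have Pv: "P (e \<cdot> x0) \<cdot>\<^bsub>B\<^esub> P v = P (e \<cdot> x0)"
      using amap_Comp'[of "e \<cdot> x0" "R v"] x0v g by (simp add: sub_Rst)
    have R01: "RB (P (e \<cdot> x1)) = RB (P (e \<cdot> x0))"
      using amap_Rst'[of "e \<cdot> x0"] amap_Rst'[of "e \<cdot> x1"] R0 R1 by simp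
    have Pc: "P (e \<cdot> x1) \<cdot>\<^bsub>B\<^esub> P c = P (e \<cdot> x0)"
      using amap_Comp'[of "e \<cdot> x1" c] amap_Comp'[of "e \<cdot> x0" v] H(1) Pv by simp
    \<comment> \<open>\<open>P m\<close> is \<open>P c\<close> followed by \<open>P v\<close>. The
      cone equation turns \<open>P (e \<cdot> x1)\<close> followed by \<open>P c\<close> into
      \<open>P (e \<cdot> x0)\<close>, which absorbs \<open>P v\<close>.\<close>
    have Pm: "P (e \<cdot> x1) \<cdot>\<^bsub>B\<^esub> P m = P (e \<cdot> x0)"
      using Pc Pv g ov B.assoc[of "P (e \<cdot> x1)" "P c" "P v"] by (simp del: amap_Comp')
    obtain k where k: "k \<in> Arr E" "Dom E k = X" "Cod E k = Dom E m" "P k = P (e \<cdot> x1)" "k \<cdot> m = e \<cdot> x0"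
      by (rule pr_lift[OF g(1), of "e \<cdot> x0" "P (e \<cdot> x1)"]) (use Pm R01 oc in \<open>simp_all del: amap_Comp'\<close>)
    have Rk: "R k = e" using k(4) k R1 R_reflect[of k "e \<cdot> x1"] by simp
    have km: "k \<cdot> R m = k" using E.Comp_Rst_eq_iff[of k m] k Rk R0 by simp
    have ku: "k \<cdot> R u = k" using km g by simp
    have "k \<cdot> u = e \<cdot> x1"
    proof (rule pr_unique[OF g(4)])
      show "k \<cdot> u \<cdot> c = e \<cdot> x1 \<cdot> c"
        using k g(9) H(1) E.assoc[of k m v] by (simp add: E.assoc)
      show "P (k \<cdot> u) = P (e \<cdot> x1)"
        using k g(11) amap_Comp'[of k "R m"] km by (simp del: amap_Comp' add: amap_Comp'[of k u])
      show "k \<cdot> u \<cdot> R c = k \<cdot> u" using k g by (simp add: E.assoc)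
    qed (use k in simp_all)
    show ?thesis
    proof (rule ex1I[of _ k])
      show "k \<in> hom E X (Dom E m) \<and> R k = e \<and> rle E (k \<cdot> m) x0 \<and> rle E (k \<cdot> u) x1 \<and> k \<cdot> R m = k \<and> k \<cdot> R u = k"
        using k Rk km ku \<open>k \<cdot> u = e \<cdot> x1\<close> R0 R1 by (simp add: hom_def rle_def)
      fix k'
      assume "k' \<in> hom E X (Dom E m) \<and> R k' = e \<and> rle E (k' \<cdot> m) x0 \<and> rle E (k' \<cdot> u) x1 \<and> k' \<cdot> R m = k' \<and> k' \<cdot> R u = k'"
      then have k': "k' \<in> Arr E" "Dom E k' = X" "Cod E k' = Dom E m" "R k' = e" "k' \<cdot> R m = k'" "k' \<cdot> R u = k'"
        and le: "R (k' \<cdot> m) \<cdot> x0 = k' \<cdot> m" "R (k' \<cdot> u) \<cdot> x1 = k' \<cdot> u"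
        unfolding hom_def rle_def by blast+
      have "R (k' \<cdot> m) = e" "R (k' \<cdot> u) = e"
        using k' E.Comp_Rst_eq_iff[of k' m] E.Comp_Rst_eq_iff[of k' u] by simp_all
      with le have m': "k' \<cdot> m = e \<cdot> x0" and u': "k' \<cdot> u = e \<cdot> x1" by simp_all
      \<comment> \<open>Because \<open>R m\<close> and \<open>u\<close> have the same image, the
        image of \<open>k'\<close> can be read off from its triangle with \<open>u\<close>.\<close>
      have "P k' = P (k' \<cdot> R m)" using k' by simp
      also have "\<dots> = P (k' \<cdot> u)" using k'(1,3) g(11) by simp
      finally have "P k' = P (e \<cdot> x1)" using u' by simp
      then show "k' = k"
        using k(1,3,4,5) k'(1,3,5) m' by - (rule pr_unique[OF g(1)], simp_all)
    qed
  qed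
  show ?thesis unfolding latent_pullback_def
    using g ex by simp
qed

text \<open>The given square is compared with a dual square on the same \<open>c\<close> and
  \<open>v\<close>, which is a latent pullback as well. The universal properties give
  \<open>k\<close> and \<open>l\<close> between the apexes. Subverticality of \<open>u\<close> and
  \<open>u0\<close> then makes \<open>P u\<close> and \<open>P u0\<close> absorb each other, and the
  equality of these idempotents carries over to \<open>P m\<close> and \<open>P m0\<close>.\<close>

lemma dual_square_if_latent_pullback:
  assumes lp: "latent_pullback E m v u c" and pm: "pr m" and sv: "sub v" and pc: "pr c" and su: "sub u"
  shows "dual_square m v u c"
proof -
  have ar [simp]: "m \<in> Arr E" "v \<in> Arr E" "u \<in> Arr E" "c \<in> Arr E" "Cod E m = Dom E v" "Dom E m = Dom E u"
      "Cod E u = Dom E c" "Cod E v = Cod E c"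
    and sq: "m \<cdot> v = u \<cdot> c" "m \<cdot> R v = m" "u \<cdot> R c = u"
    and univ: "\<And>X x0 x1 e. \<lbrakk>X \<in> Obj E; x0 \<in> hom E X (Dom E v); x1 \<in> hom E X (Dom E c); e \<in> rst_idems E X;
      e \<cdot> x1 \<cdot> c = e \<cdot> x0 \<cdot> v; rle E e (R (x1 \<cdot> c)); rle E e (R (x0 \<cdot> v))\<rbrakk> \<Longrightarrow>
      \<exists>!k. k \<in> hom E X (Dom E m) \<and> R k = e \<and> rle E (k \<cdot> m) x0 \<and> rle E (k \<cdot> u) x1 \<and> k \<cdot> R m = k \<and> k \<cdot> R u = k"
    using lp unfolding latent_pullback_def by auto
  obtain m0 u0 where g0: "dual_square m0 v u0 c" using dual_square_exists[OF pc sv] by auto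
  note g = dual_squareD[OF g0] dual_square_facts[OF g0]
  have [simp]: "m0 \<in> Arr E" "u0 \<in> Arr E" "Cod E m0 = Dom E v" "Dom E m0 = Dom E u0" "Cod E u0 = Dom E c"
    using g by simp_all
  have univ0: "\<And>X x0 x1 e. \<lbrakk>X \<in> Obj E; x0 \<in> hom E X (Dom E v); x1 \<in> hom E X (Dom E c); e \<in> rst_idems E X;
      e \<cdot> x1 \<cdot> c = e \<cdot> x0 \<cdot> v; rle E e (R (x1 \<cdot> c)); rle E e (R (x0 \<cdot> v))\<rbrakk> \<Longrightarrow>
      \<exists>!k. k \<in> hom E X (Dom E m0) \<and> R k = e \<and> rle E (k \<cdot> m0) x0 \<and> rle E (k \<cdot> u0) x1 \<and> k \<cdot> R m0 = k \<and> k \<cdot> R u0 = k"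
    using latent_pullback_if_dual_square[OF g0] unfolding latent_pullback_def by auto
  have Rm: "R (m \<cdot> v) = R m" and Ru: "R (u \<cdot> c) = R u"
    using sq E.Comp_Rst_eq_iff[of m v] E.Comp_Rst_eq_iff[of u c] by simp_all
  then have Rmu: "R m = R u" using sq by simp
  have Rum: "R u \<cdot> m = m" using Rmu E.Rst_Comp_self[of m] by simp
  have Rum0: "R u0 \<cdot> m0 = m0" using g E.Rst_Comp_self[of m0] by simp
  have Rm0: "R (m0 \<cdot> v) = R m0" and Ru0: "R (u0 \<cdot> c) = R u0"
    using g E.Comp_Rst_eq_iff[of m0 v] E.Comp_Rst_eq_iff[of u0 c] by simp_all
  have "\<exists>!k. k \<in> hom E (Dom E u) (Dom E m0) \<and> R k = R m \<and> rle E (k \<cdot> m0) m \<and> rle E (k \<cdot> u0) u \<and> k \<cdot> R m0 = k \<and> k \<cdot> R u0 = k"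
    by (rule univ0) (use sq Rm Ru Rmu Rum in \<open>simp_all add: hom_def rst_idems_def rle_def\<close>)
  then obtain k where k: "k \<in> Arr E" "Dom E k = Dom E u" "Cod E k = Dom E u0" "R k = R u"
      "R (k \<cdot> m0) \<cdot> m = k \<cdot> m0" "R (k \<cdot> u0) \<cdot> u = k \<cdot> u0" "k \<cdot> R u0 = k"
    using Rmu by (auto simp: hom_def rle_def)
  have km: "k \<cdot> m0 = m" and ku: "k \<cdot> u0 = u"
    using k g Rmu E.Comp_Rst_eq_iff[of k m0] E.Comp_Rst_eq_iff[of k u0] by (metis ar E.Rst_Comp_self
      \<open>m0 \<in> Arr E\<close> \<open>u0 \<in> Arr E\<close> \<open>Dom E m0 = Dom E u0\<close>)+
  have "\<exists>!k. k \<in> hom E (Dom E u0) (Dom E m) \<and> R k = R m0 \<and> rle E (k \<cdot> m) m0 \<and> rle E (k \<cdot> u) u0 \<and> k \<cdot> R m = k \<and> k \<cdot> R u = k"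
    by (rule univ) (use g Rm0 Ru0 Rum0 in \<open>simp_all add: hom_def rst_idems_def rle_def\<close>)
  then obtain l where l: "l \<in> Arr E" "Dom E l = Dom E u0" "Cod E l = Dom E u" "R l = R u0"
      "R (l \<cdot> m) \<cdot> m0 = l \<cdot> m" "R (l \<cdot> u) \<cdot> u0 = l \<cdot> u" "l \<cdot> R u = l"
    using g by (auto simp: hom_def rle_def)
  have lm: "l \<cdot> m = m0" and lu: "l \<cdot> u = u0"
    using l g Rmu E.Comp_Rst_eq_iff[of l m] E.Comp_Rst_eq_iff[of l u] by (metis ar E.Rst_Comp_self
      \<open>m0 \<in> Arr E\<close> \<open>u0 \<in> Arr E\<close> \<open>Dom E m0 = Dom E u0\<close>)+
  have kl: "k \<cdot> l = R k"
  proof -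
    \<comment> \<open>Both \<open>R u\<close> and \<open>k \<cdot> l\<close> mediate from the square
      to itself, so uniqueness identifies them.\<close>
    have 1: "\<exists>!j. j \<in> hom E (Dom E u) (Dom E m) \<and> R j = R m \<and> rle E (j \<cdot> m) m \<and> rle E (j \<cdot> u) u \<and> j \<cdot> R m = j \<and> j \<cdot> R u = j"
      by (rule univ) (use sq Rm Ru Rmu Rum in \<open>simp_all add: hom_def rst_idems_def rle_def\<close>)
    have a: "k \<cdot> l \<cdot> m = m" "k \<cdot> l \<cdot> u = u" using k l km ku lm lu by (simp_all add: E.assoc)
    have b: "R (k \<cdot> l) = R u" using k l E.Comp_Rst_eq_iff[of k l] by simp
    have c: "k \<cdot> l \<cdot> R u = k \<cdot> l" using k l by (simp add: E.assoc)
    have "R u \<in> hom E (Dom E u) (Dom E m) \<and> R (R u) = R m \<and> rle E (R u \<cdot> m) m \<and> rle E (R u \<cdot> u) u \<and> R u \<cdot> R m = R u \<and> R u \<cdot> R u = R u"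
      using Rmu E.Rst_Comp_self[of m] by (simp add: hom_def rle_def)
    moreover have "k \<cdot> l \<in> hom E (Dom E u) (Dom E m) \<and> R (k \<cdot> l) = R m \<and> rle E (k \<cdot> l \<cdot> m) m \<and> rle E (k \<cdot> l \<cdot> u) u \<and> k \<cdot> l \<cdot> R m = k \<cdot> l \<and> k \<cdot> l \<cdot> R u = k \<cdot> l"
      using k l a b c Rmu E.Rst_Comp_self[of m] by (simp add: hom_def rle_def)
    ultimately have "k \<cdot> l = R u" using 1 by blast
    then show ?thesis using k by simp
  qed
  have "P k \<cdot>\<^bsub>B\<^esub> P u0 = P k"
    using k amap_Comp'[of k "R u0"] sub_Rst[OF g(12)] by simp
  then have Pk: "P k = P u" using amap_Comp'[of k u0] k ku by simp
  have Pk': "P k \<cdot>\<^bsub>B\<^esub> P u = P u" using Pk sub_idem[OF su] by simp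
  have ou: "omap p (Dom E u0) = omap p (Dom E c)" "omap p (Dom E u) = omap p (Dom E c)"
    using sub_omap[of u0] sub_omap[of u] su g by simp_all
  have "P u \<cdot>\<^bsub>B\<^esub> P l = P u"
    using kl Pk k l amap_Comp'[of k l] sub_Rst[OF su] by simp
  have Pl: "P l \<cdot>\<^bsub>B\<^esub> P u = P l" using amap_Comp'[of l "R u"] l sub_Rst[OF su] by simp
  have "P u0 = P l" using lu Pl amap_Comp'[of l u] l by simp
  then have "P u \<cdot>\<^bsub>B\<^esub> P u0 = P u" and "P u0 \<cdot>\<^bsub>B\<^esub> P u = P u0"
    using \<open>P u \<cdot>\<^bsub>B\<^esub> P l = P u\<close> Pl by simp_all
  \<comment> \<open>Two commuting idempotents that absorb each other are equal.\<close>
  then have Pu: "P u = P u0"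
    using B.idem_Comp(1)[of "P u" "P u0"] sub_Rst[OF su] sub_Rst[OF g(12)] ou by simp
  have "P m = P u \<cdot>\<^bsub>B\<^esub> P m0" using km Pk amap_Comp'[of k m0] k by simp
  also have "\<dots> = P m0" using Pu g(11) B.Rst_Comp_self[of "P m0"] by simp
  finally have Pm: "P m = P m0" .
  show ?thesis unfolding dual_square_def using pm sv pc sq Pm Pu g by simp
qed

lemma dual_square_iff: "dual_square m v u c \<longleftrightarrow> latent_pullback E m v u c \<and> pr m \<and> sub v \<and> pr c \<and> sub u"
  using latent_pullback_if_dual_square dual_square_if_latent_pullback dual_squareD dual_square_facts by metis

section \<open>Spans and the dual category\<close>

abbreviation "spans \<equiv> dual_spans E B p"
abbreviation "cls \<equiv> span_class E B p"

lemma spansD: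
  assumes "(v, c) \<in> spans"
  shows "sub v" "pr c" "v \<in> Arr E" "c \<in> Arr E" "Dom E v = Dom E c" "R v = R c" "P v = RB (P c)"
    "omap p (Cod E v) = omap p (Dom E c)"
proof -
  show 1: "sub v" "pr c" "v \<in> Arr E" "c \<in> Arr E" "Dom E v = Dom E c" "R v = R c"
    using assms by (auto simp: dual_spans_def)
  show "P v = RB (P c)"
    using 1 amap_Rst'[of v] by (simp add: sub_Rst)
  show "omap p (Cod E v) = omap p (Dom E c)"
    using 1 sub_omap[of v] by simp
qed

lemma spansI: "\<lbrakk>sub v; pr c; Dom E v = Dom E c; P v = RB (P c)\<rbrakk> \<Longrightarrow> (v, c) \<in> spans"
  using R_reflect[of v c] by (simp add: dual_spans_def)

section \<open>Equivalence of spans\<close>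

lemma span_rel_iff:
  "((v, c), (v', c')) \<in> span_rel E B p \<longleftrightarrow>
    (v, c) \<in> spans \<and> (v', c') \<in> spans \<and> Cod E v = Cod E v' \<and> Cod E c = Cod E c' \<and>
    (\<exists>a b. a \<in> hom E (Dom E v) (Dom E v') \<and> sub a \<and> partial_inverse E a b \<and>
       a \<cdot> v' = v \<and> a \<cdot> c' = c \<and> b \<cdot> v = v' \<and> b \<cdot> c = c' \<and> R a = R c \<and> R b = R c')"
  by (simp add: span_rel_def)

text \<open>\<open>P a\<close> is an idempotent and hence its own partial inverse, so the inverse
  \<open>b\<close> has the same image. Each of \<open>P c\<close> and \<open>P c'\<close> is then
  the other one preceded by this idempotent, which makes them equal.\<close>

lemma span_relD:
  assumes "((v, c), (v', c')) \<in> span_rel E B p"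
  shows "(v, c) \<in> spans" "(v', c') \<in> spans" "Cod E v = Cod E v'" "Cod E c = Cod E c'" "P c = P c'"
    "\<exists>a\<in>Arr E. Dom E a = Dom E c \<and> Cod E a = Dom E c' \<and> P a = RB (P c) \<and> a \<cdot> c' = c \<and> a \<cdot> v' = v"
proof -
  show DS: "(v, c) \<in> spans" "(v', c') \<in> spans" and "Cod E v = Cod E v'" "Cod E c = Cod E c'"
    using assms unfolding span_rel_iff by blast+
  note d = spansD[OF DS(1)] and d' = spansD[OF DS(2)]
  obtain a b where h: "a \<in> hom E (Dom E v) (Dom E v')" and sa: "sub a"
    and ab: "partial_inverse E a b"
    and eq: "a \<cdot> v' = v" "a \<cdot> c' = c" "b \<cdot> c = c'" and Ra: "R a = R c"
    using assms unfolding span_rel_iff by blast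
  have a: "a \<in> Arr E" "Dom E a = Dom E c" "Cod E a = Dom E c'" using h d d' by (simp_all add: hom_def)
  have b: "b \<in> Arr E" "Dom E b = Dom E c'" "Cod E b = Dom E c" and inv: "a \<cdot> b = R a" "b \<cdot> a = R b"
    using ab a by (auto simp: partial_inverse_def hom_def)
  have oa: "omap p (Dom E c') = omap p (Dom E c)" using sub_omap[OF sa] a by simp
  have Pa: "P a = RB (P c)" using sub_Rst[OF sa] a Ra d amap_Rst'[of a] by simp
  have "partial_inverse B (P a) (P b)"
    using a b oa inv amap_Comp'[of a b] amap_Comp'[of b a] by (simp add: partial_inverse_def hom_def)
  moreover have "partial_inverse B (P a) (P a)"
    using a oa sub_idem[OF sa] sub_Rst[OF sa] by (simp add: partial_inverse_def hom_def)
  ultimately have Pb: "P b = P a" by (rule B.partial_inverse_unique)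
  have 1: "P a \<cdot>\<^bsub>B\<^esub> P c' = P c" using amap_Comp'[of a c'] eq a d' by simp
  have 2: "P a \<cdot>\<^bsub>B\<^esub> P c = P c'" using amap_Comp'[of b c] eq b d Pb by simp
  show "P c = P c'"
    using 1 2 B.assoc[of "P a" "P a" "P c'"] sub_idem[OF sa] a d' oa by simp
  show "\<exists>a\<in>Arr E. Dom E a = Dom E c \<and> Cod E a = Dom E c' \<and> P a = RB (P c) \<and> a \<cdot> c' = c \<and> a \<cdot> v' = v"
    using a Pa eq by auto
qed

text \<open>One comparison arrow suffices. As \<open>P c = P c'\<close>, the candidate inverse
  \<open>b\<close> is the subvertical filler of \<open>c'\<close> through \<open>c\<close>; both
  composites are found by cancelling prone arrows, and \<open>b \<cdot> a = R c'\<close> gives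
  compatibility with the left legs.\<close>

lemma span_relI:
  assumes "(v, c) \<in> spans" "(v', c') \<in> spans" "Cod E c = Cod E c'" "P c = P c'"
    and a: "a \<in> Arr E" "Dom E a = Dom E c" "Cod E a = Dom E c'" "P a = RB (P c)" and ac: "a \<cdot> c' = c" and av: "a \<cdot> v' = v"
  shows "((v, c), (v', c')) \<in> span_rel E B p"
proof -
  note d = spansD[OF assms(1)] and d' = spansD[OF assms(2)]
  have [simp]: "v \<in> Arr E" "c \<in> Arr E" "v' \<in> Arr E" "c' \<in> Arr E" "Dom E v = Dom E c" "Dom E v' = Dom E c'"
    using d d' by simp_all
  have oc: "omap p (Dom E c') = omap p (Dom E c)" using assms(4) d(4) d'(4) by (metis Dom_amap)
  have sa: "sub a" using a by (intro subI) simp_all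
  have Ra: "R a = R c" using a by (intro R_reflect) simp_all
  have aRc: "a \<cdot> R c' = a" using E.Comp_Rst_eq_iff[of a c'] a ac Ra by simp
  obtain b where b: "sub b" "Dom E b = Dom E c'" "Cod E b = Dom E c" "P b = RB (P c')" "b \<cdot> c = c'"
      "R b = R c'" "b \<cdot> R c = b"
  proof (rule subvertical_lift[OF d(2), of c'])
    show "RB (P c') \<cdot>\<^bsub>B\<^esub> P c = P c'" using assms(4) B.Rst_Comp_self[of "P c'"] by simp
  qed (use assms(3) oc in simp_all)
  have [simp]: "b \<in> Arr E" using b by simp
  have "a \<cdot> b = R c"
  proof (rule pr_unique[OF d(2)])
    show "a \<cdot> b \<cdot> c = R c \<cdot> c" using a b ac by (simp add: E.assoc)
    show "P (a \<cdot> b) = P (R c)" using a b assms(4) by simp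
    show "a \<cdot> b \<cdot> R c = a \<cdot> b" using a b by (simp add: E.assoc)
  qed (use a b in simp_all)
  moreover have ba: "b \<cdot> a = R c'"
  proof (rule pr_unique[OF d'(2)])
    show "b \<cdot> a \<cdot> c' = R c' \<cdot> c'" using a b ac by (simp add: E.assoc)
    show "P (b \<cdot> a) = P (R c')" using a b assms(4) by simp
    show "b \<cdot> a \<cdot> R c' = b \<cdot> a" using a b aRc by (simp add: E.assoc)
  qed (use a b in simp_all)
  moreover have "b \<cdot> v = v'"
    using E.assoc[of b a v'] a b av ba d'(6) E.Rst_Comp_self[of v'] by simp
  moreover have "Cod E v = Cod E v'" using av a E.Cod_Comp[of a v'] by simp
  moreover have "a \<in> hom E (Dom E v) (Dom E v')" using a by (simp add: hom_def)
  moreover have "partial_inverse E a b"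
    using a b Ra calculation(1,2) by (simp add: partial_inverse_def hom_def)
  ultimately show ?thesis
    unfolding span_rel_iff using assms(1-3) sa Ra ac av b(5,6) by blast
qed

lemma span_rel_refl: "(v, c) \<in> spans \<Longrightarrow> ((v, c), (v, c)) \<in> span_rel E B p"
  using spansD[of v c] E.Rst_Comp_self[of v] by (auto intro!: span_relI[of v c v c "R c"])

lemma span_rel_sym:
  assumes "((v, c), (v', c')) \<in> span_rel E B p"
  shows "((v', c'), (v, c)) \<in> span_rel E B p"
proof -
  note s = span_relD[OF assms]
  note d = spansD[OF s(1)] and d' = spansD[OF s(2)]
  obtain a b where h: "a \<in> hom E (Dom E v) (Dom E v')" and sa: "sub a"
    and ab: "partial_inverse E a b" and eq: "b \<cdot> v = v'" "b \<cdot> c = c'" and Rb: "R b = R c'"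
    using assms unfolding span_rel_iff by blast
  have a: "a \<in> Arr E" "Dom E a = Dom E c" "Cod E a = Dom E c'" using h d d' by (simp_all add: hom_def)
  have b: "b \<in> Arr E" "Dom E b = Dom E c'" "Cod E b = Dom E c" and inv: "a \<cdot> b = R a" "b \<cdot> a = R b"
    using ab a by (auto simp: partial_inverse_def hom_def)
  have oa: "omap p (Dom E c') = omap p (Dom E c)" using sub_omap[OF sa] a by simp
  have "partial_inverse B (P a) (P b)"
    using a b oa inv amap_Comp'[of a b] amap_Comp'[of b a] by (simp add: partial_inverse_def hom_def)
  moreover have "partial_inverse B (P a) (P a)"
    using a oa sub_idem[OF sa] sub_Rst[OF sa] by (simp add: partial_inverse_def hom_def)
  ultimately have "P b = P a" by (rule B.partial_inverse_unique)
  then have "P b = RB (P c')" using b Rb d' sub_Rst[OF sa] amap_Rst'[of b] by simp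
  then show ?thesis
    using s b eq by (intro span_relI[of v' c' v c b]) simp_all
qed

lemma span_rel_trans:
  assumes "((v, c), (v', c')) \<in> span_rel E B p" "((v', c'), (v'', c'')) \<in> span_rel E B p"
  shows "((v, c), (v'', c'')) \<in> span_rel E B p"
proof -
  note s = span_relD[OF assms(1)] and t = span_relD[OF assms(2)]
  note d = spansD[OF s(1)] and d' = spansD[OF s(2)] and d'' = spansD[OF t(2)]
  obtain a where a: "a \<in> Arr E" "Dom E a = Dom E c" "Cod E a = Dom E c'" "P a = RB (P c)" "a \<cdot> c' = c" "a \<cdot> v' = v"
    using s(6) by blast
  obtain b where b: "b \<in> Arr E" "Dom E b = Dom E c'" "Cod E b = Dom E c''" "P b = RB (P c')" "b \<cdot> c'' = c'" "b \<cdot> v'' = v'"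
    using t(6) by blast
  show ?thesis
  proof (rule span_relI)
    show "P (a \<cdot> b) = RB (P c)" using a b s(5) d'(4) by simp
  qed (use s(1,4,5) t(2,4,5) a b d(4) d'(3-5) d''(3-5) in \<open>simp_all add: E.assoc\<close>)
qed

lemma in_cls_iff: "(v', c') \<in> cls v c \<longleftrightarrow> ((v, c), (v', c')) \<in> span_rel E B p"
  unfolding span_class_def by auto

lemma cls_eqI:
  assumes "((v, c), (v', c')) \<in> span_rel E B p"
  shows "cls v c = cls v' c'"
proof (intro set_eqI)
  fix s :: "'m \<times> 'm"
  obtain w d where "s = (w, d)" by fastforce
  moreover have "(w, d) \<in> cls v c \<longleftrightarrow> (w, d) \<in> cls v' c'"
    unfolding in_cls_iff
    using span_rel_trans[OF assms, of w d] span_rel_trans[OF span_rel_sym[OF assms], of w d] by (rule iffI[rotated])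
  ultimately show "s \<in> cls v c \<longleftrightarrow> s \<in> cls v' c'"
    by (simp only:)
qed

lemma cls_self: "(v, c) \<in> spans \<Longrightarrow> (v, c) \<in> cls v c"
  unfolding span_class_def using span_rel_refl by auto

lemma cls_eq_iff:
  "(v, c) \<in> spans \<Longrightarrow> (v', c') \<in> spans \<Longrightarrow> cls v c = cls v' c' \<longleftrightarrow> ((v, c), (v', c')) \<in> span_rel E B p"
  using cls_eqI[of v c v' c'] cls_self[of v' c'] unfolding in_cls_iff[symmetric] by blast

section \<open>Composition of spans and its independence of choices\<close>

lemma spans_Comp:
  assumes "(v1, c1) \<in> spans" "(v2, c2) \<in> spans" "dual_square m v2 u c1"
  shows "(u \<cdot> v1, m \<cdot> c2) \<in> spans" "P (m \<cdot> c2) = P c1 \<cdot>\<^bsub>B\<^esub> P c2" "RB (P (m \<cdot> c2)) = RB (P m)"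
proof -
  note d1 = spansD[OF assms(1)] and d2 = spansD[OF assms(2)] and g = dual_squareD[OF assms(3)] and f = dual_square_facts[OF assms(3)]
  have [simp]: "m \<in> Arr E" "u \<in> Arr E" "c1 \<in> Arr E" "c2 \<in> Arr E" "v1 \<in> Arr E" "v2 \<in> Arr E"
    "Cod E m = Dom E c2" "Cod E u = Dom E v1" "Dom E m = Dom E u" "Dom E v1 = Dom E c1" "Dom E v2 = Dom E c2"
    using d1 d2 g by simp_all
  have oc: "omap p (Cod E c1) = omap p (Dom E c2)" using g(8) d2(8) by simp
  \<comment> \<open>\<open>P v2\<close> is the restriction of \<open>P c2\<close> and is absorbed by
    it. This is functoriality of the projection, before passing to classes.\<close>
  show 1: "P (m \<cdot> c2) = P c1 \<cdot>\<^bsub>B\<^esub> P c2"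
    using g(10) d2(7) oc by (simp add: B.assoc)
  show 2: "RB (P (m \<cdot> c2)) = RB (P m)"
    using f(2) d2(7) B.Rst_Comp_Rst[of "P m" "P c2"] by simp
  have 3: "P (u \<cdot> v1) = RB (P m)"
    using g(11) d1(7) f(6) by simp
  have "sub (u \<cdot> v1)" using 3 by (intro subI) simp_all
  then show "(u \<cdot> v1, m \<cdot> c2) \<in> spans"
    using 2 3 pr_Comp[OF g(1) d2(2)] by (intro spansI) simp_all
qed

text \<open>Independence of the representatives and of the square is proved at once. The comparison
  of the composites is the filler of \<open>m \<cdot> a2\<close> through the prone
  \<open>m'\<close>; cancelling \<open>c1'\<close> shows that it respects the left legs.\<close>

lemma cls_Comp_cong:
  assumes r1: "((v1, c1), (v1', c1')) \<in> span_rel E B p" and r2: "((v2, c2), (v2', c2')) \<in> span_rel E B p"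
    and G: "dual_square m v2 u c1" "dual_square m' v2' u' c1'"
  shows "cls (u \<cdot> v1) (m \<cdot> c2) = cls (u' \<cdot> v1') (m' \<cdot> c2')"
proof -
  note s1 = span_relD[OF r1] and s2 = span_relD[OF r2]
  note d1 = spansD[OF s1(1)] and d1' = spansD[OF s1(2)] and d2 = spansD[OF s2(1)] and d2' = spansD[OF s2(2)]
  note g = dual_squareD[OF G(1)] and g' = dual_squareD[OF G(2)] and f = dual_square_facts[OF G(1)] and f' = dual_square_facts[OF G(2)]
  obtain a1 where a1: "a1 \<in> Arr E" "Dom E a1 = Dom E c1" "Cod E a1 = Dom E c1'" "P a1 = RB (P c1)" "a1 \<cdot> c1' = c1" "a1 \<cdot> v1' = v1"
    using s1(6) by blast
  obtain a2 where a2: "a2 \<in> Arr E" "Dom E a2 = Dom E c2" "Cod E a2 = Dom E c2'" "P a2 = RB (P c2)" "a2 \<cdot> c2' = c2" "a2 \<cdot> v2' = v2"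
    using s2(6) by blast
  have [simp]: "m \<in> Arr E" "u \<in> Arr E" "c1 \<in> Arr E" "c2 \<in> Arr E" "v1 \<in> Arr E" "v2 \<in> Arr E"
    "Cod E m = Dom E c2" "Cod E u = Dom E c1" "Dom E m = Dom E u" "Dom E v1 = Dom E c1" "Dom E v2 = Dom E c2"
    "m' \<in> Arr E" "u' \<in> Arr E" "c1' \<in> Arr E" "c2' \<in> Arr E" "v1' \<in> Arr E" "v2' \<in> Arr E"
    "Cod E m' = Dom E c2'" "Cod E u' = Dom E c1'" "Dom E m' = Dom E u'" "Dom E v1' = Dom E c1'" "Dom E v2' = Dom E c2'"
    using d1 d2 g d1' d2' g' by simp_all
  note [simp] = a1(1,2,3) a2(1,2,3)
  have PP: "P v2' = P v2" "P c1' = P c1" "P c2' = P c2" using d2(7) d2'(7) s1(5) s2(5) by simp_all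
  then have Pm': "P m' = P m" using g(10) g'(10) by simp
  have Pma: "P (m \<cdot> a2) = P m" using f(2) d2(7) a2(4) by simp
  have oo: "omap p (Dom E u) = omap p (Dom E u')"
    using Pm' Dom_amap[of m] Dom_amap[of m'] by simp
  obtain a where a: "sub a" "Dom E a = Dom E (m \<cdot> a2)" "Cod E a = Dom E m'" "P a = RB (P (m \<cdot> a2))" "a \<cdot> m' = m \<cdot> a2"
      "R a = R (m \<cdot> a2)" "a \<cdot> R m' = a"
  proof (rule subvertical_lift[OF g'(1), of "m \<cdot> a2"])
    show "RB (P (m \<cdot> a2)) \<cdot>\<^bsub>B\<^esub> P m' = P (m \<cdot> a2)" unfolding Pma Pm' by simp
  qed (use oo in simp_all)
  have [simp]: "a \<in> Arr E" "Dom E a = Dom E u" "Cod E a = Dom E u'" using a by simp_all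
  have Pa: "P a = RB (P m)" using a Pma by simp
  have au: "a \<cdot> u' = u \<cdot> a1"
  proof (rule pr_unique[OF d1'(2)])
    have "a \<cdot> u' \<cdot> c1' = a \<cdot> m' \<cdot> v2'" using g'(9) by (simp add: E.assoc)
    also have "\<dots> = m \<cdot> v2" unfolding a(5) using a2(6) by (simp add: E.assoc)
    also have "\<dots> = u \<cdot> a1 \<cdot> c1'" using g(9) a1(5) by (simp add: E.assoc)
    finally show "a \<cdot> u' \<cdot> c1' = u \<cdot> a1 \<cdot> c1'" .
    show "P (a \<cdot> u') = P (u \<cdot> a1)"
      using Pa g'(11) g(11) Pm' a1(4) f(6) by simp
    show "a \<cdot> u' \<cdot> R c1' = a \<cdot> u'" using f'(5) by (simp add: E.assoc)
  qed simp_all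
  show ?thesis
  proof (rule cls_eqI, rule span_relI)
    show "(u \<cdot> v1, m \<cdot> c2) \<in> spans" "(u' \<cdot> v1', m' \<cdot> c2') \<in> spans"
      using spans_Comp s1 s2 G by blast+
    show "P (m \<cdot> c2) = P (m' \<cdot> c2')" using Pm' PP by simp
    show "P a = RB (P (m \<cdot> c2))" using Pa spans_Comp(3)[OF s1(1) s2(1) G(1)] by simp
    show "a \<cdot> (m' \<cdot> c2') = m \<cdot> c2"
      using a(5) a2(5) by (simp add: E.assoc[symmetric]) (simp add: E.assoc)
    show "a \<cdot> (u' \<cdot> v1') = u \<cdot> v1"
      using au a1(6) by (simp add: E.assoc[symmetric]) (simp add: E.assoc)
  qed (use s2(4) in simp_all)
qed

section \<open>The operations of the dual on representatives\<close>

abbreviation "D \<equiv> fib_dual E B p"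
abbreviation "q \<equiv> fib_dual_proj E B p"

lemma Obj_D [simp]: "Obj D = Obj E"
  by (simp add: fib_dual_def)

lemma Arr_D: "s \<in> Arr D \<longleftrightarrow> (\<exists>v c. (v, c) \<in> spans \<and> s = cls v c)"
  by (auto simp: fib_dual_def)

lemma cls_Arr [simp]: "(v, c) \<in> spans \<Longrightarrow> cls v c \<in> Arr D"
  by (auto simp: Arr_D)

text \<open>Well-definedness, in the form shared by domain, codomain, restriction and projection: a
  value constant on a class is the one described by \<open>THE\<close>.\<close>

lemma the_cls:
  assumes "(v, c) \<in> spans" "\<And>v' c'. ((v, c), (v', c')) \<in> span_rel E B p \<Longrightarrow> f v' c' = f v c"
  shows "(THE x. \<exists>(v', c')\<in>cls v c. x = f v' c') = f v c"
proof (rule the_equality)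
  show "\<exists>(v', c')\<in>cls v c. f v c = f v' c'"
    using cls_self[OF assms(1)] by blast
  show "x = f v c" if "\<exists>(v', c')\<in>cls v c. x = f v' c'" for x
    using that assms(2) unfolding in_cls_iff[symmetric] by blast
qed

lemma Dom_D [simp]: "(v, c) \<in> spans \<Longrightarrow> Dom D (cls v c) = Cod E v"
  using the_cls[of v c "\<lambda>v c. Cod E v"] span_relD(3) by (auto simp: fib_dual_def)

lemma Cod_D [simp]: "(v, c) \<in> spans \<Longrightarrow> Cod D (cls v c) = Cod E c"
  using the_cls[of v c "\<lambda>v c. Cod E c"] span_relD(4) by (auto simp: fib_dual_def)

lemma Idm_D: "Idm D X = cls (Idm E X) (Idm E X)"
  by (simp add: fib_dual_def)

lemma omap_q [simp]: "omap q = omap p"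
  by (simp add: fib_dual_proj_def)

lemma amap_q [simp]: "(v, c) \<in> spans \<Longrightarrow> amap q (cls v c) = P c"
  using the_cls[of v c "\<lambda>v c. P c"] span_relD(5) by (auto simp: fib_dual_proj_def)

lemma Comp_D:
  assumes s1: "(v1, c1) \<in> spans" and s2: "(v2, c2) \<in> spans" and g: "dual_square m v2 u c1"
  shows "cls v1 c1 \<cdot>\<^bsub>D\<^esub> cls v2 c2 = cls (u \<cdot> v1) (m \<cdot> c2)"
proof -
  let ?Q = "\<lambda>s. \<exists>(v1, c1)\<in>cls v1 c1. \<exists>(v2, c2)\<in>cls v2 c2. \<exists>v2' c1'.
                latent_pullback E c1' v2 v2' c1 \<and> sub v2' \<and> pr c1' \<and> s = cls (v2' \<cdot> v1) (c1' \<cdot> c2)"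
  have "(THE s. ?Q s) = cls (u \<cdot> v1) (m \<cdot> c2)"
  proof (rule the_equality)
    show "?Q (cls (u \<cdot> v1) (m \<cdot> c2))"
      using cls_self[OF s1] cls_self[OF s2] g unfolding dual_square_iff by blast
    fix s assume "?Q s"
    then obtain v1' c1' v2' c2' u' m' where r: "((v1, c1), (v1', c1')) \<in> span_rel E B p"
        "((v2, c2), (v2', c2')) \<in> span_rel E B p"
      and lp: "latent_pullback E m' v2' u' c1'" "sub u'" "pr m'" and s: "s = cls (u' \<cdot> v1') (m' \<cdot> c2')"
      unfolding in_cls_iff by (auto simp: in_cls_iff)
    have "dual_square m' v2' u' c1'"
      unfolding dual_square_iff using lp spansD[OF span_relD(2)[OF r(1)]] spansD[OF span_relD(2)[OF r(2)]] by blast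
    then show "s = cls (u \<cdot> v1) (m \<cdot> c2)" using cls_Comp_cong[OF r g] s by simp
  qed
  then show ?thesis by (simp add: fib_dual_def)
qed

lemma hat_eq:
  assumes v: "v \<in> Arr E" and e: "e \<in> Arr E" "R e = e" "Dom E e = Cod E v" "P e = P v"
  shows "hat E p v = e"
  unfolding hat_def
proof (rule the_equality)
  have ce: "Cod E e = Dom E e" using e E.Cod_Rst[of e] by simp
  with e show "e \<in> rst_idems E (Cod E v) \<and> P e = P v" by (simp add: rst_idems_def hom_def)
  fix d assume "d \<in> rst_idems E (Cod E v) \<and> P d = P v"
  then show "d = e" using e R_reflect[of d e] by (simp add: rst_idems_def hom_def)
qed

lemma hat:
  assumes v: "sub v"
  shows "hat E p v \<in> Arr E" "R (hat E p v) = hat E p v" "Dom E (hat E p v) = Cod E v"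
    "Cod E (hat E p v) = Cod E v" "P (hat E p v) = P v"
proof -
  obtain e where e: "e \<in> Arr E" "Dom E e = Cod E v" "Cod E e = Cod E v" "R e = e" "P e = P v"
    using idem_over[of "Cod E v" "P v"] v sub_Rst[OF v] sub_omap[OF v] by auto
  then have "hat E p v = e" using v by (intro hat_eq) simp_all
  with e show "hat E p v \<in> Arr E" "R (hat E p v) = hat E p v" "Dom E (hat E p v) = Cod E v"
    "Cod E (hat E p v) = Cod E v" "P (hat E p v) = P v" by simp_all
qed

lemma idem_span: "\<lbrakk>e \<in> Arr E; R e = e\<rbrakk> \<Longrightarrow> (e, e) \<in> spans"
  using sub_R[of e] pr_R[of e] by (simp add: dual_spans_def)

text \<open>The hat depends only on \<open>P v\<close> and the codomain of \<open>v\<close>, which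
  are invariants of the class because \<open>P v\<close> is the restriction of
  \<open>P c\<close>.\<close>

lemma Rst_D:
  assumes "(v, c) \<in> spans" "e \<in> Arr E" "R e = e" "Dom E e = Cod E v" "P e = P v"
  shows "Rst D (cls v c) = cls e e"
proof -
  have "Rst D (cls v c) = cls (hat E p v) (hat E p v)"
  proof -
    have "hat E p v' = hat E p v" if "((v, c), (v', c')) \<in> span_rel E B p" for v' c'
    proof -
      note s = span_relD[OF that]
      note d = spansD[OF s(1)] and d' = spansD[OF s(2)]
      show ?thesis
        using hat[OF d(1)] d d' s by (intro hat_eq) simp_all
    qed
    then show ?thesis
      using the_cls[OF assms(1), of "\<lambda>v c. cls (hat E p v) (hat E p v)"] by (simp add: fib_dual_def)
  qed
  then show ?thesis using hat_eq[of v e] spansD[OF assms(1)] assms by simp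
qed

lemma idemD:
  assumes "e \<in> Arr E" "R e = e"
  shows "Cod E e = Dom E e" "RB (P e) = P e" "e \<cdot> e = e"
  using assms E.Cod_Rst[of e] amap_Rst'[of e] E.Rst_Comp_self[of e] by simp_all

lemma Comp_cls_exists:
  assumes "(v1, c1) \<in> spans" "(v2, c2) \<in> spans" "Cod E c1 = Cod E v2"
  obtains m u where "dual_square m v2 u c1" "cls v1 c1 \<cdot>\<^bsub>D\<^esub> cls v2 c2 = cls (u \<cdot> v1) (m \<cdot> c2)"
proof -
  obtain m u where g: "dual_square m v2 u c1"
    using dual_square_exists[of c1 v2] spansD[OF assms(1)] spansD[OF assms(2)] assms(3) by metis
  show ?thesis using that[OF g Comp_D[OF assms(1,2) g]] .
qed

lemma Comp_idem_left:
  assumes s: "(v, c) \<in> spans" and e: "e \<in> Arr E" "R e = e" "Dom E e = Cod E v"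
  shows "cls e e \<cdot>\<^bsub>D\<^esub> cls v c = cls (v \<cdot> e) (R (v \<cdot> e) \<cdot> c)"
proof -
  note d = spansD[OF s] and i = idemD[OF e(1,2)]
  have [simp]: "v \<in> Arr E" "Cod E v = Dom E e" "e \<in> Arr E" "Cod E e = Dom E e" using d e i by simp_all
  have o: "omap p (Dom E v) = omap p (Dom E e)" using sub_omap[OF d(1)] by simp
  have r: "RB (P v) = P v" using d(1) by (rule sub_Rst)
  have c: "P v \<cdot>\<^bsub>B\<^esub> P e = P e \<cdot>\<^bsub>B\<^esub> P v" "RB (P v \<cdot>\<^bsub>B\<^esub> P e) = P v \<cdot>\<^bsub>B\<^esub> P e"
    using B.idem_Comp[of "P v" "P e"] r i o by simp_all
  \<comment> \<open>Along an idempotent the pullback is explicit: the apex of the span is kept and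
    cut down to the domain of \<open>v \<cdot> e\<close>. The square commutes by (R.4).\<close>
  have "dual_square (R (v \<cdot> e)) v (v \<cdot> e) e"
    unfolding dual_square_def using pr_R[of "R (v \<cdot> e)"] pr_R[OF e(1,2)] d(1) c E.Comp_Rst[of v e] e(2) E.assoc[of v e e] i(3) by simp
  from Comp_D[OF idem_span[OF e(1,2)] s this] show ?thesis using i by (simp add: E.assoc)
qed

lemma Comp_idem_right:
  assumes s: "(v, c) \<in> spans" and e: "e \<in> Arr E" "R e = e" "Dom E e = Cod E c"
  shows "cls v c \<cdot>\<^bsub>D\<^esub> cls e e = cls (R (c \<cdot> e) \<cdot> v) (c \<cdot> e)"
proof -
  note d = spansD[OF s] and i = idemD[OF e(1,2)]
  have [simp]: "c \<in> Arr E" "Cod E c = Dom E e" "e \<in> Arr E" "Cod E e = Dom E e" using d e i by simp_all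
  have "dual_square (c \<cdot> e) e (R (c \<cdot> e)) c"
    unfolding dual_square_def using pr_Comp[OF d(2) pr_R[OF e(1,2)]] d(2) sub_R[OF e(1)] E.Comp_Rst[of c e] e(2) i
    by (simp add: E.assoc)
  from Comp_D[OF s idem_span[OF e(1,2)] this] show ?thesis using i by (simp add: E.assoc)
qed

lemma Comp_idems:
  assumes e: "e \<in> Arr E" "R e = e" and d: "d \<in> Arr E" "R d = d" "Dom E d = Dom E e"
  shows "cls e e \<cdot>\<^bsub>D\<^esub> cls d d = cls (e \<cdot> d) (e \<cdot> d)"
proof -
  note i = idemD[OF e] and j = idemD[OF d(1,2)]
  have 1: "d \<cdot> e = e \<cdot> d" "R (e \<cdot> d) = e \<cdot> d" using E.idem_Comp[OF d(1) e(1) d(2) e(2)] E.idem_Comp[OF e(1) d(1) e(2) d(2)] d(3) by simp_all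
  have "cls e e \<cdot>\<^bsub>D\<^esub> cls d d = cls (d \<cdot> e) (R (d \<cdot> e) \<cdot> d)"
    by (rule Comp_idem_left) (use e d i j idem_span in simp_all)
  also have "R (d \<cdot> e) \<cdot> d = e \<cdot> d" using 1 e d i j by (simp add: E.assoc)
  finally show ?thesis using 1 by simp
qed

section \<open>The restriction category axioms for the dual\<close>

lemma Idm_span: "X \<in> Obj E \<Longrightarrow> (Idm E X, Idm E X) \<in> spans"
  by (rule idem_span) simp_all

lemma hom_D: "s \<in> hom D X Y \<longleftrightarrow> (\<exists>v c. (v, c) \<in> spans \<and> s = cls v c \<and> Cod E v = X \<and> Cod E c = Y)"
  unfolding hom_def by (auto simp: Arr_D) blast

lemma hom_DI: "\<lbrakk>(v, c) \<in> spans; Cod E v = X; Cod E c = Y\<rbrakk> \<Longrightarrow> cls v c \<in> hom D X Y"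
  unfolding hom_D by blast

lemma Rst_D_hat: "(v, c) \<in> spans \<Longrightarrow> Rst D (cls v c) = cls (hat E p v) (hat E p v)"
  using spansD[of v c] hat[of v] by (intro Rst_D) simp_all

text \<open>A third square, on \<open>m\<close> and \<open>u'\<close>, is pasted to each of the two
  given ones. The results are dual squares for the two iterated composites, with the same legs up to
  associativity in \<open>E\<close>.\<close>

lemma Comp_D_assoc:
  assumes s: "(v1, c1) \<in> spans" "(v2, c2) \<in> spans" "(v3, c3) \<in> spans" and "Cod E c1 = Cod E v2" "Cod E c2 = Cod E v3"
  shows "(cls v1 c1 \<cdot>\<^bsub>D\<^esub> cls v2 c2) \<cdot>\<^bsub>D\<^esub> cls v3 c3 = cls v1 c1 \<cdot>\<^bsub>D\<^esub> (cls v2 c2 \<cdot>\<^bsub>D\<^esub> cls v3 c3)"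
proof -
  note d1 = spansD[OF s(1)] and d2 = spansD[OF s(2)] and d3 = spansD[OF s(3)]
  obtain m u where g0: "dual_square m v2 u c1" and c12: "cls v1 c1 \<cdot>\<^bsub>D\<^esub> cls v2 c2 = cls (u \<cdot> v1) (m \<cdot> c2)"
    using Comp_cls_exists[OF s(1,2) assms(4)] .
  obtain m' u' where g0': "dual_square m' v3 u' c2" and c23: "cls v2 c2 \<cdot>\<^bsub>D\<^esub> cls v3 c3 = cls (u' \<cdot> v2) (m' \<cdot> c3)"
    using Comp_cls_exists[OF s(2,3) assms(5)] .
  note g = dual_squareD[OF g0] and f = dual_square_facts[OF g0] and g' = dual_squareD[OF g0'] and f' = dual_square_facts[OF g0']
  obtain r t where h0: "dual_square r u' t m"
    using dual_square_exists[of m u'] g g' f' d2 by metis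
  note h = dual_squareD[OF h0] and k = dual_square_facts[OF h0]
  have [simp]: "m \<in> Arr E" "u \<in> Arr E" "c1 \<in> Arr E" "c2 \<in> Arr E" "c3 \<in> Arr E" "v1 \<in> Arr E" "v2 \<in> Arr E" "v3 \<in> Arr E"
    "m' \<in> Arr E" "u' \<in> Arr E" "r \<in> Arr E" "t \<in> Arr E"
    "Cod E m = Dom E c2" "Cod E u = Dom E c1" "Dom E m = Dom E u" "Dom E v1 = Dom E c1" "Dom E v2 = Dom E c2"
    "Dom E v3 = Dom E c3" "Cod E m' = Dom E c3" "Cod E u' = Dom E c2" "Dom E m' = Dom E u'"
    "Cod E r = Dom E u'" "Cod E t = Dom E u" "Dom E r = Dom E t" "Cod E v2 = Cod E c1" "Cod E v3 = Cod E c2"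
    using d1(3-5) d2(3-5) d3(3-5) assms(4,5) g(1,3,5-7) g'(1,3,5-7) h(1,3,5-7) by simp_all
  have ov: "omap p (Cod E c1) = omap p (Dom E c2)" using d2(8) by simp
  have ou: "omap p (Dom E u') = omap p (Dom E c2)" using sub_omap[OF f'(1)] by simp
  have ov3: "omap p (Cod E c2) = omap p (Dom E c3)" using d3(8) by simp
  \<comment> \<open>Restriction idempotents on one base object commute; the second pasting needs
    \<open>P v2\<close> moved past \<open>P u'\<close>.\<close>
  have vu: "P v2 \<cdot>\<^bsub>B\<^esub> P u' = P u' \<cdot>\<^bsub>B\<^esub> P v2"
    using B.idem_Comp(1)[of "P v2" "P u'"] d2(1) f'(1) ov ou by (simp add: sub_Rst)
  have ru: "P u' \<cdot>\<^bsub>B\<^esub> P m' = P m'" unfolding g'(11) by simp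
  have rr: "P r \<cdot>\<^bsub>B\<^esub> P m' = P m \<cdot>\<^bsub>B\<^esub> P m'"
    unfolding h(10) using ru ou by (simp add: B.assoc)
  have Rr: "RB (P r \<cdot>\<^bsub>B\<^esub> P m') = RB (P r)"
    using B.Comp_Rst_eq_iff[of "P r" "P m'"] k(2) g'(11) by simp
  have 1: "dual_square (r \<cdot> m') v3 t (m \<cdot> c2)"
    unfolding dual_square_def
  proof (intro conjI)
    have "r \<cdot> m' \<cdot> v3 = r \<cdot> u' \<cdot> c2" using g'(9) by (simp add: E.assoc)
    also have "\<dots> = t \<cdot> (m \<cdot> c2)" using h(9) by (simp add: E.assoc)
    finally show "r \<cdot> m' \<cdot> v3 = t \<cdot> (m \<cdot> c2)" .
    show "P (r \<cdot> m') = P (m \<cdot> c2) \<cdot>\<^bsub>B\<^esub> P v3"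
    proof -
      have "P (r \<cdot> m') = P m \<cdot>\<^bsub>B\<^esub> P m'" using rr by simp
      also have "\<dots> = P (m \<cdot> c2) \<cdot>\<^bsub>B\<^esub> P v3" using g'(10) ov3 by (simp add: B.assoc)
      finally show ?thesis .
    qed
    show "P t = RB (P (r \<cdot> m'))" using h(11) Rr by simp
  qed (use d3 pr_Comp[OF h(1) g'(1)] pr_Comp[OF g(1) d2(2)] in simp_all)
  have 2: "dual_square r (u' \<cdot> v2) (t \<cdot> u) c1"
    unfolding dual_square_def
  proof (intro conjI)
    have "r \<cdot> (u' \<cdot> v2) = t \<cdot> m \<cdot> v2" using h(9) by (simp add: E.assoc[symmetric])
    also have "\<dots> = t \<cdot> u \<cdot> c1" using g(9) by (simp add: E.assoc)
    finally show "r \<cdot> (u' \<cdot> v2) = t \<cdot> u \<cdot> c1" .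
    show "P r = P c1 \<cdot>\<^bsub>B\<^esub> P (u' \<cdot> v2)"
      using vu ov ou unfolding h(10) g(10) by (simp add: B.assoc)
    show "P (t \<cdot> u) = RB (P r)" using h(11) g(11) k(6) by simp
    show "sub (u' \<cdot> v2)" using spans_Comp(1)[OF s(2,3) g0'] by (rule spansD)
  qed (use h d1 in simp_all)
  have "(cls v1 c1 \<cdot>\<^bsub>D\<^esub> cls v2 c2) \<cdot>\<^bsub>D\<^esub> cls v3 c3 = cls (t \<cdot> (u \<cdot> v1)) (r \<cdot> m' \<cdot> c3)"
    unfolding c12 by (rule Comp_D[OF spans_Comp(1)[OF s(1,2) g0] s(3) 1])
  also have "\<dots> = cls (t \<cdot> u \<cdot> v1) (r \<cdot> (m' \<cdot> c3))" by (simp add: E.assoc)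
  also have "\<dots> = cls v1 c1 \<cdot>\<^bsub>D\<^esub> (cls v2 c2 \<cdot>\<^bsub>D\<^esub> cls v3 c3)"
    unfolding c23 by (rule Comp_D[OF s(1) spans_Comp(1)[OF s(2,3) g0'] 2, symmetric])
  finally show ?thesis .
qed

text \<open>Both sides are the span \<open>(v1, c1)\<close> cut down by an idempotent, on the right
  by that of \<open>v2\<close> and on the left by that of the composite. The two cuts agree since
  \<open>c1 \<cdot> ?e\<close> and \<open>v1 \<cdot> ?d\<close> both have a restriction lying over
  \<open>RB (P m)\<close>.\<close>

lemma Rst_D_Comp_le:
  assumes s: "(v1, c1) \<in> spans" and t: "(v2, c2) \<in> spans" and [simp]: "Cod E c1 = Cod E v2"
  shows "cls v1 c1 \<cdot>\<^bsub>D\<^esub> Rst D (cls v2 c2) = Rst D (cls v1 c1 \<cdot>\<^bsub>D\<^esub> cls v2 c2) \<cdot>\<^bsub>D\<^esub> cls v1 c1"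
proof -
  note d1 = spansD[OF s] and d2 = spansD[OF t]
  obtain m u where g0: "dual_square m v2 u c1" and c: "cls v1 c1 \<cdot>\<^bsub>D\<^esub> cls v2 c2 = cls (u \<cdot> v1) (m \<cdot> c2)"
    using Comp_cls_exists[OF s t] by auto
  note g = dual_squareD[OF g0] and f = dual_square_facts[OF g0] and sp = spans_Comp[OF s t g0]
  let ?e = "hat E p v2" and ?d = "hat E p (u \<cdot> v1)"
  note e = hat[OF d2(1)] and d = hat[OF spansD(1)[OF sp(1)]]
  have [simp]: "u \<in> Arr E" "v1 \<in> Arr E" "c1 \<in> Arr E" "Cod E u = Dom E v1" "Dom E c1 = Dom E v1"
    using d1(3,4,5) g(3,6) by simp_all
  have [simp]: "?e \<in> Arr E" "Dom E ?e = Cod E c1" "Cod E ?e = Cod E c1"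
    using e(1,3,4) by simp_all
  have [simp]: "?d \<in> Arr E" "Dom E ?d = Cod E v1" "Cod E ?d = Cod E v1"
    using d(1,3,4) by simp_all
  have Pd: "P ?d = RB (P m)" using d(5) spansD(7)[OF sp(1)] sp(3) by simp
  have "RB (P (c1 \<cdot> ?e)) = RB (P (v1 \<cdot> ?d))"
  proof -
    have "P (c1 \<cdot> ?e) = P m" using e(5) g(10) by simp
    moreover have "P (v1 \<cdot> ?d) = RB (P c1) \<cdot>\<^bsub>B\<^esub> RB (P m)" using Pd d1(7) by simp
    moreover have "RB (P c1) \<cdot>\<^bsub>B\<^esub> RB (P m) = RB (P m)"
    proof -
      have "omap p (Cod E v2) = omap p (Dom E v2)" by (rule sub_omap[OF d2(1)])
      then show ?thesis unfolding g(10) using B.Rst_le_left[of "P c1" "P v2"] d2(3) by simp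
    qed
    ultimately show ?thesis using g(1) by simp
  qed
  then have R: "R (c1 \<cdot> ?e) = R (v1 \<cdot> ?d)" by (intro R_reflect) simp_all
  have "cls v1 c1 \<cdot>\<^bsub>D\<^esub> Rst D (cls v2 c2) = cls (R (c1 \<cdot> ?e) \<cdot> v1) (c1 \<cdot> ?e)"
    using Comp_idem_right[OF s e(1,2)] Rst_D_hat[OF t] by simp
  also have "R (c1 \<cdot> ?e) \<cdot> v1 = v1 \<cdot> ?d" unfolding R using E.Comp_Rst[of v1 ?d] d(2) by simp
  also have "c1 \<cdot> ?e = R (v1 \<cdot> ?d) \<cdot> c1" unfolding R[symmetric] using E.Comp_Rst[of c1 ?e] e(2) by simp
  also have "cls (v1 \<cdot> ?d) (R (v1 \<cdot> ?d) \<cdot> c1) = Rst D (cls v1 c1 \<cdot>\<^bsub>D\<^esub> cls v2 c2) \<cdot>\<^bsub>D\<^esub> cls v1 c1"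
    using Comp_idem_left[OF s d(1,2)] Rst_D_hat[OF sp(1)] c by simp
  finally show ?thesis .
qed

lemma dual_restriction_category: "restriction_category D"
proof
  show "Dom D f \<in> Obj D" "Cod D f \<in> Obj D" if "f \<in> Arr D" for f
    using that spansD by (auto simp: Arr_D)
  show "Idm D X \<in> hom D X X" if "X \<in> Obj D" for X
    unfolding Idm_D using that Idm_span[of X] by (intro hom_DI) simp_all
  show "f \<cdot>\<^bsub>D\<^esub> g \<in> hom D X Z" if fg: "f \<in> hom D X Y" "g \<in> hom D Y Z" for f g X Y Z
  proof -
    obtain v1 c1 v2 c2 where s: "(v1, c1) \<in> spans" "f = cls v1 c1" "Cod E v1 = X" "Cod E c1 = Y"
      "(v2, c2) \<in> spans" "g = cls v2 c2" "Cod E v2 = Y" "Cod E c2 = Z"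
      using fg unfolding hom_D by blast
    obtain m u where m: "dual_square m v2 u c1" "f \<cdot>\<^bsub>D\<^esub> g = cls (u \<cdot> v1) (m \<cdot> c2)"
      using Comp_cls_exists[OF s(1,5)] s by auto
    then show ?thesis
      using s spans_Comp(1)[OF s(1,5) m(1)] dual_squareD[OF m(1)] spansD[OF s(1)] spansD[OF s(5)]
      by (auto intro!: hom_DI)
  qed
  show "(f \<cdot>\<^bsub>D\<^esub> g) \<cdot>\<^bsub>D\<^esub> h = f \<cdot>\<^bsub>D\<^esub> (g \<cdot>\<^bsub>D\<^esub> h)" if "f \<in> hom D W X" "g \<in> hom D X Y" "h \<in> hom D Y Z" for f g h W X Y Z
    using that unfolding hom_D by (elim exE conjE) (simp add: Comp_D_assoc)
  show "Idm D X \<cdot>\<^bsub>D\<^esub> f = f" if f: "f \<in> hom D X Y" for f X Y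
  proof -
    obtain v c where s: "(v, c) \<in> spans" "f = cls v c" "Cod E v = X" "Cod E c = Y"
      using f unfolding hom_D by blast
    note d = spansD[OF s(1)]
    have X: "X \<in> Obj E" using d s E.Cod_in[of v] by simp
    have "R v \<cdot> c = c" using d by simp
    then show ?thesis
      using Comp_idem_left[OF s(1), of "Idm E X"] s X d(3) by (simp add: Idm_D)
  qed
  show "f \<cdot>\<^bsub>D\<^esub> Idm D Y = f" if f: "f \<in> hom D X Y" for f X Y
  proof -
    obtain v c where s: "(v, c) \<in> spans" "f = cls v c" "Cod E v = X" "Cod E c = Y"
      using f unfolding hom_D by blast
    note d = spansD[OF s(1)]
    have X: "Y \<in> Obj E" using d s E.Cod_in[of c] by simp
    have "R c \<cdot> v = v" using d(3) d(6)[symmetric] by simp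
    then show ?thesis
      using Comp_idem_right[OF s(1), of "Idm E Y"] s X d(4) by (simp add: Idm_D)
  qed
  show "Rst D f \<in> hom D X X" if f: "f \<in> hom D X Y" for f X Y
  proof -
    obtain v c where s: "(v, c) \<in> spans" "f = cls v c" "Cod E v = X" "Cod E c = Y"
      using f unfolding hom_D by blast
    show ?thesis
      unfolding s(2) Rst_D_hat[OF s(1)] using s hat[OF spansD(1)[OF s(1)]] idem_span by (intro hom_DI) simp_all
  qed
  show "Rst D f \<cdot>\<^bsub>D\<^esub> f = f" if f: "f \<in> hom D X Y" for f X Y
  proof -
    obtain v c where s: "(v, c) \<in> spans" "f = cls v c" "Cod E v = X" "Cod E c = Y"
      using f unfolding hom_D by blast
    note d = spansD[OF s(1)] and h = hat[OF spansD(1)[OF s(1)]]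
    \<comment> \<open>The hat of \<open>v\<close> has the idempotent image \<open>P v\<close>, so
      \<open>v\<close> is total over its own hat and absorbs it.\<close>
    have "R (v \<cdot> hat E p v) = R v"
      using d(3) h sub_idem[OF d(1)] by (intro R_reflect) simp_all
    moreover have "v \<cdot> hat E p v = v"
      using calculation E.Comp_Rst_eq_iff[of v "hat E p v"] d(3) h by simp
    moreover have "R v \<cdot> c = c" using d by simp
    ultimately show ?thesis
      unfolding s(2) Rst_D_hat[OF s(1)] using Comp_idem_left[OF s(1) h(1-3)] by simp
  qed
  show "Rst D f \<cdot>\<^bsub>D\<^esub> Rst D g = Rst D g \<cdot>\<^bsub>D\<^esub> Rst D f" if fg: "f \<in> hom D X Y" "g \<in> hom D X Z" for f g X Y Z
  proof -
    obtain v1 c1 v2 c2 where s: "(v1, c1) \<in> spans" "f = cls v1 c1" "Cod E v1 = X"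
      "(v2, c2) \<in> spans" "g = cls v2 c2" "Cod E v2 = X"
      using fg unfolding hom_D by blast
    note h1 = hat[OF spansD(1)[OF s(1)]] and h2 = hat[OF spansD(1)[OF s(4)]]
    show ?thesis
      unfolding s Rst_D_hat[OF s(1)] Rst_D_hat[OF s(4)]
      using Comp_idems[of "hat E p v1" "hat E p v2"] Comp_idems[of "hat E p v2" "hat E p v1"]
        E.idem_Comp(1)[of "hat E p v1" "hat E p v2"] h1 h2 s by simp
  qed
  show "Rst D (Rst D f \<cdot>\<^bsub>D\<^esub> g) = Rst D f \<cdot>\<^bsub>D\<^esub> Rst D g" if fg: "f \<in> hom D X Y" "g \<in> hom D X Z" for f g X Y Z
  proof -
    obtain v1 c1 v2 c2 where s: "(v1, c1) \<in> spans" "f = cls v1 c1" "Cod E v1 = X"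
      "(v2, c2) \<in> spans" "g = cls v2 c2" "Cod E v2 = X"
      using fg unfolding hom_D by blast
    let ?e = "hat E p v1" and ?d = "hat E p v2"
    note e = hat[OF spansD(1)[OF s(1)]] and d = hat[OF spansD(1)[OF s(4)]] and d2 = spansD[OF s(4)]
    have [simp]: "v2 \<in> Arr E" "c2 \<in> Arr E" "Dom E v2 = Dom E c2" using d2 by simp_all
    have o: "omap p (Dom E c2) = omap p X" using sub_omap[OF d2(1)] s by simp
    have ed: "?e \<cdot> ?d \<in> Arr E" "R (?e \<cdot> ?d) = ?e \<cdot> ?d" using E.idem_Comp(2)[of ?e ?d] e d s by simp_all
    \<comment> \<open>\<open>?d\<close> has the same image as \<open>v2\<close>, and the idempotents
      commute in \<open>B\<close>. Hence \<open>?e \<cdot> ?d\<close> is the hat of the left leg of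
      the cut-down span.\<close>
    have Pv: "P (v2 \<cdot> ?e) = P (?e \<cdot> ?d)"
      using B.idem_Comp(1)[of "P v2" "P ?e"] amap_Arr[of ?e] Dom_amap[of ?e] e d s o d2(1) idemD[OF e(1,2)] by (simp add: sub_Rst)
    have RPv: "RB (P (v2 \<cdot> ?e)) = P (v2 \<cdot> ?e)" unfolding Pv using idemD(2)[OF ed] .
    have sp: "(v2 \<cdot> ?e, R (v2 \<cdot> ?e) \<cdot> c2) \<in> spans"
    proof (rule spansI)
      show "sub (v2 \<cdot> ?e)" using RPv e s by (intro subI) simp_all
      show "pr (R (v2 \<cdot> ?e) \<cdot> c2)" using pr_R[of "R (v2 \<cdot> ?e)"] e s d2 by (intro pr_Comp) simp_all
      have "RB (P (R (v2 \<cdot> ?e) \<cdot> c2)) = P (R (v2 \<cdot> ?e)) \<cdot>\<^bsub>B\<^esub> P v2"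
        using B.Rst_Rst_Comp[of "P (v2 \<cdot> ?e)" "P c2"] d2(7) e(1-4) s o by simp
      also have "\<dots> = P (v2 \<cdot> ?e)"
        using B.Rst_le_right[of "P v2" "P ?e"] e(1-4) s RPv d2(1) by (simp add: sub_Rst)
      finally show "P (v2 \<cdot> ?e) = RB (P (R (v2 \<cdot> ?e) \<cdot> c2))" ..
    qed (use e s in simp_all)
    have "Rst D (Rst D f \<cdot>\<^bsub>D\<^esub> g) = Rst D (cls (v2 \<cdot> ?e) (R (v2 \<cdot> ?e) \<cdot> c2))"
      using Comp_idem_left[OF s(4) e(1,2)] e s Rst_D_hat[OF s(1)] by simp
    also have "\<dots> = cls (?e \<cdot> ?d) (?e \<cdot> ?d)"
      by (rule Rst_D[OF sp ed]) (use Pv e d s in simp_all)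
    also have "\<dots> = Rst D f \<cdot>\<^bsub>D\<^esub> Rst D g"
      using Comp_idems[of ?e ?d] e d s Rst_D_hat[OF s(1)] Rst_D_hat[OF s(4)] by simp
    finally show ?thesis .
  qed
  show "f \<cdot>\<^bsub>D\<^esub> Rst D g = Rst D (f \<cdot>\<^bsub>D\<^esub> g) \<cdot>\<^bsub>D\<^esub> f" if "f \<in> hom D X Y" "g \<in> hom D Y Z" for f g X Y Z
    using that unfolding hom_D by (elim exE conjE) (simp add: Rst_D_Comp_le)
qed

section \<open>The dual is a latent hyperfibration\<close>

definition prone_class :: "'m \<Rightarrow> ('m \<times> 'm) set" where
  "prone_class c = cls (R c) c"

lemma prone_class_span: "pr c \<Longrightarrow> (R c, c) \<in> spans"
  by (intro spansI) simp_all

lemma prone_class_simps [simp]: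
  assumes "pr c"
  shows "prone_class c \<in> Arr D" "Dom D (prone_class c) = Dom E c" "Cod D (prone_class c) = Cod E c" "amap q (prone_class c) = P c"
  using prone_class_span[OF assms] assms by (simp_all add: prone_class_def)

lemma Comp_prone_class:
  assumes s: "(w, b) \<in> spans" and c: "pr c" and bc: "Cod E b = Dom E c"
  shows "cls w b \<cdot>\<^bsub>D\<^esub> prone_class c = cls (R (b \<cdot> c) \<cdot> w) (b \<cdot> c)"
  unfolding prone_class_def
proof -
  note d = spansD[OF s]
  have [simp]: "b \<in> Arr E" "c \<in> Arr E" using d c by simp_all
  have "pr (b \<cdot> R c)" using pr_Comp[OF d(2) pr_R[of "R c"]] bc by simp
  then have "dual_square (b \<cdot> R c) (R c) (R (b \<cdot> c)) b"
    unfolding dual_square_def using d(2) bc E.Comp_Rst[of b c, symmetric] by (simp add: E.assoc)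
  from Comp_D[OF s prone_class_span[OF c] this] show "cls w b \<cdot>\<^bsub>D\<^esub> cls (R c) c = cls (R (b \<cdot> c) \<cdot> w) (b \<cdot> c)"
    using bc by (simp add: E.assoc)
qed

lemma Comp_prone_class_total:
  assumes s: "(w, b) \<in> spans" and c: "pr c" and bc: "Cod E b = Dom E c" and tot: "b \<cdot> R c = b"
  shows "cls w b \<cdot>\<^bsub>D\<^esub> prone_class c = cls w (b \<cdot> c)" "(w, b \<cdot> c) \<in> spans"
proof -
  note d = spansD[OF s]
  have [simp]: "b \<in> Arr E" "c \<in> Arr E" using d c by simp_all
  have R: "R (b \<cdot> c) = R w" using tot bc E.Comp_Rst_eq_iff[of b c] d(6) by simp
  then show "cls w b \<cdot>\<^bsub>D\<^esub> prone_class c = cls w (b \<cdot> c)"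
    unfolding Comp_prone_class[OF s c bc] using d(3) by simp
  show "(w, b \<cdot> c) \<in> spans"
    using pr_Comp[OF d(2) c bc] d bc R by (simp add: dual_spans_def)
qed

lemma dual_semifunctor: "restriction_semifunctor D B q"
proof (intro restriction_semifunctor.intro dual_restriction_category B.restriction_category_axioms
    restriction_semifunctor_axioms.intro)
  show "omap q X \<in> Obj B" if "X \<in> Obj D" for X using that by simp
  show "amap q f \<in> hom B (omap q X) (omap q Y)" if "f \<in> hom D X Y" for f X Y
    using that spansD unfolding hom_D by (auto simp: hom_def)
  show "amap q (f \<cdot>\<^bsub>D\<^esub> g) = amap q f \<cdot>\<^bsub>B\<^esub> amap q g" if fg: "f \<in> hom D X Y" "g \<in> hom D Y Z" for f g X Y Z
  proof -
    obtain v1 c1 v2 c2 where s: "(v1, c1) \<in> spans" "f = cls v1 c1" "Cod E v1 = X" "Cod E c1 = Y"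
      "(v2, c2) \<in> spans" "g = cls v2 c2" "Cod E v2 = Y" "Cod E c2 = Z"
      using fg unfolding hom_D by blast
    obtain m u where m: "dual_square m v2 u c1" "f \<cdot>\<^bsub>D\<^esub> g = cls (u \<cdot> v1) (m \<cdot> c2)"
      using Comp_cls_exists[OF s(1,5)] s by auto
    show ?thesis
      unfolding m(2) amap_q[OF spans_Comp(1)[OF s(1,5) m(1)]] spans_Comp(2)[OF s(1,5) m(1)] using s by simp
  qed
  show "amap q (Rst D f) = RB (amap q f)" if f: "f \<in> hom D X Y" for f X Y
  proof -
    obtain v c where s: "(v, c) \<in> spans" "f = cls v c"
      using f unfolding hom_D by blast
    note h = hat[OF spansD(1)[OF s(1)]]
    show ?thesis
      unfolding s(2) Rst_D_hat[OF s(1)] using s idem_span[OF h(1,2)] h(5) spansD(7)[OF s(1)] by simp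
  qed
qed

text \<open>The filler of \<open>(w, d)\<close> keeps the left leg \<open>w\<close> and replaces
  \<open>d\<close> by its filler \<open>b\<close> through \<open>c\<close> in \<open>E\<close>,
  which is prone by cancellation. For uniqueness, equality of the composites with the class of
  \<open>c\<close> yields a comparison arrow that already compares the fillers.\<close>

lemma prone_class_prone:
  assumes c: "pr c"
  shows "prone D B q (prone_class c)"
  unfolding prone_def
proof (intro conjI ballI impI)
  have [simp]: "c \<in> Arr E" using c by simp
  show "prone_class c \<in> Arr D" using c by simp
  fix Y g h
  assume "Y \<in> Obj D" and g: "g \<in> hom D Y (Cod D (prone_class c))" and h: "h \<in> hom B (omap q Y) (omap q (Dom D (prone_class c)))"
    and pt: "precise_triangle B h (amap q (prone_class c)) (amap q g)"
  obtain w d where s: "(w, d) \<in> spans" "g = cls w d" "Cod E w = Y" "Cod E d = Cod E c"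
    using g c unfolding hom_D by auto
  note d = spansD[OF s(1)]
  have hB: "h \<in> Arr B" "Dom B h = omap p (Dom E d)" "Cod B h = omap p (Dom E c)"
    using h c d(8) s(3) by (auto simp: hom_def)
  have hc: "h \<cdot>\<^bsub>B\<^esub> P c = P d" "RB h = RB (P d)"
    using pt c s(1,2) by (auto simp: precise_triangle_def)
  obtain b where b: "b \<in> Arr E" "Dom E b = Dom E d" "Cod E b = Dom E c" "P b = h" "b \<cdot> c = d"
    by (rule pr_lift[OF c, of d h]) (use d s hB hc in simp_all)
  have "R d = R b" using b d hc by (intro R_reflect) simp_all
  then have bRc: "b \<cdot> R c = b" using b E.Comp_Rst_eq_iff[of b c] by simp
  have pb: "pr b" by (rule pr_cancel[OF c]) (use b d bRc in simp_all)
  have wb: "(w, b) \<in> spans" by (rule spansI) (use d b pb hc in simp_all)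
  have k: "cls w b \<cdot>\<^bsub>D\<^esub> prone_class c = cls w d" using Comp_prone_class_total[OF wb c b(3) bRc] b(5) by simp
  show "\<exists>!k. k \<in> hom D Y (Dom D (prone_class c)) \<and> amap q k = h \<and> precise_triangle D k (prone_class c) g"
  proof (rule ex1I[of _ "cls w b"])
    show "cls w b \<in> hom D Y (Dom D (prone_class c)) \<and> amap q (cls w b) = h \<and> precise_triangle D (cls w b) (prone_class c) g"
      unfolding precise_triangle_def k s(2) Rst_D_hat[OF wb] Rst_D_hat[OF s(1)]
      using wb c s b by (auto intro!: hom_DI)
    fix k'
    assume "k' \<in> hom D Y (Dom D (prone_class c)) \<and> amap q k' = h \<and> precise_triangle D k' (prone_class c) g"
    then obtain v b' where k': "(v, b') \<in> spans" "k' = cls v b'" "Cod E v = Y" "Cod E b' = Dom E c" "P b' = h"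
      and eq: "cls v b' \<cdot>\<^bsub>D\<^esub> prone_class c = cls w d"
      using c s(2) unfolding hom_D precise_triangle_def by auto
    note d' = spansD[OF k'(1)]
    have "R (b' \<cdot> c) = R b'" using d' k' hc by (intro R_reflect) simp_all
    then have tot: "b' \<cdot> R c = b'" using d' k' E.Comp_Rst_eq_iff[of b' c] by simp
    have r: "((v, b' \<cdot> c), (w, d)) \<in> span_rel E B p"
      using eq Comp_prone_class_total[OF k'(1) c k'(4) tot] cls_eq_iff[of v "b' \<cdot> c" w d] s(1) by simp
    obtain a where a: "a \<in> Arr E" "Dom E a = Dom E (b' \<cdot> c)" "Cod E a = Dom E d" "P a = RB (P (b' \<cdot> c))"
        "a \<cdot> d = b' \<cdot> c" "a \<cdot> w = v"
      using span_relD(6)[OF r] by blast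
    have Da: "Dom E a = Dom E b'" using a(2) d' k' by simp
    have Pa: "P a = RB h" using a(4) d' k' hc by simp
    \<comment> \<open>The arrow \<open>a\<close> is only known to respect the right legs after
      composition with \<open>c\<close>; proneness of \<open>c\<close> removes that
      composition.\<close>
    have ab: "a \<cdot> b = b'"
    proof (rule pr_unique[OF c])
      show "a \<cdot> b \<cdot> c = b' \<cdot> c" using a b by (simp add: E.assoc)
      show "P (a \<cdot> b) = P b'" using a(1,3) b k'(5) Pa hB by simp
      show "a \<cdot> b \<cdot> R c = a \<cdot> b" using a b bRc by (simp add: E.assoc)
    qed (use a b k' d' in simp_all)
    have "((v, b'), (w, b)) \<in> span_rel E B p"
      by (rule span_relI[OF k'(1) wb, of a]) (use a b k' Pa Da ab in simp_all)
    then show "k' = cls w b" using cls_eqI k'(2) by simp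
  qed
qed

text \<open>A restriction idempotent is its own restriction, and restrictions in the dual are
  classes of pairs of equal idempotents, so the idempotents of the dual on \<open>X\<close> come
  from those of \<open>E\<close>.\<close>

lemma rst_idems_D: "s \<in> rst_idems D X \<longleftrightarrow> (\<exists>e\<in>rst_idems E X. s = cls e e)"
proof
  assume "s \<in> rst_idems D X"
  then obtain v c where s: "(v, c) \<in> spans" "s = cls v c" "Cod E v = X" "Rst D s = s"
    unfolding rst_idems_def hom_D by blast
  note h = hat[OF spansD(1)[OF s(1)]]
  have "s = cls (hat E p v) (hat E p v)" using Rst_D_hat[OF s(1)] s by simp
  moreover have "hat E p v \<in> rst_idems E X" using h s by (simp add: rst_idems_def hom_def)
  ultimately show "\<exists>e\<in>rst_idems E X. s = cls e e" by blast
next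
  assume "\<exists>e\<in>rst_idems E X. s = cls e e"
  then obtain e where e: "e \<in> Arr E" "R e = e" "Dom E e = X" "Cod E e = X" "s = cls e e"
    by (auto simp: rst_idems_def hom_def)
  note sp = idem_span[OF e(1,2)]
  show "s \<in> rst_idems D X"
    unfolding rst_idems_def e(5) using Rst_D[OF sp e(1,2)] hom_DI[OF sp] e by simp
qed

lemma dual_latent_fibration: "latent_fibration D B q"
proof (intro latent_fibration.intro dual_semifunctor latent_fibration_axioms.intro)
  fix X f A
  assume X: "X \<in> Obj D" and f: "f \<in> hom B A (omap q X)" "f \<cdot>\<^bsub>B\<^esub> amap q (Idm D X) = f"
  then have "f \<cdot>\<^bsub>B\<^esub> P (Idm E X) = f" using Idm_span[of X] by (simp add: Idm_D)
  then obtain c where c: "pr c" "Cod E c = X" "P c = f"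
    using pr_lift_of[of X f] X f by (auto simp: hom_def)
  then show "\<exists>f'. prone D B q f' \<and> Cod D f' = X \<and> amap q f' = f"
    using prone_class_prone[of c] by (intro exI[of _ "prone_class c"]) simp
qed

text \<open>The idempotents of the dual are those of \<open>E\<close>, with the same images in
  \<open>B\<close> and, since \<open>cls e e\<close> and \<open>cls e' e'\<close> compose to the
  class of \<open>e \<cdot> e'\<close>, the same order. Hyperconnectedness therefore carries
  over.\<close>

lemma dual_hyperfib: "hyperfib D B q"
proof (intro hyperfib.intro latent_hyperfibration.intro dual_latent_fibration latent_hyperfibration_axioms.intro)
  have q: "amap q (cls e e) = P e" "(e, e) \<in> spans" if "e \<in> rst_idems E X" for e X
    using that idem_span[of e] by (auto simp: rst_idems_def hom_def)
  have inj: "e = e'" if "e \<in> rst_idems E X" "e' \<in> rst_idems E X" "P e = P e'" for e e' X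
    using that R_reflect[of e e'] by (auto simp: rst_idems_def hom_def)
  fix X assume X: "X \<in> Obj D"
  have im: "amap q ` rst_idems D X = P ` rst_idems E X"
    using q by (force simp: rst_idems_D image_iff)
  have "inj_on (amap q) (rst_idems D X)"
  proof (rule inj_onI)
    fix s t assume "s \<in> rst_idems D X" "t \<in> rst_idems D X" and eq: "amap q s = amap q t"
    then obtain e d where e: "e \<in> rst_idems E X" "s = cls e e" "d \<in> rst_idems E X" "t = cls d d"
      unfolding rst_idems_D by blast
    then show "s = t" using eq inj[of e X d] q(1)[of e X] q(1)[of d X] by simp
  qed
  then show "bij_betw (amap q) (rst_idems D X)
      {d \<in> rst_idems B (omap q X). d \<cdot>\<^bsub>B\<^esub> amap q (Idm D X) = d}"
    using idems_bij[of X] X im Idm_span[of X] by (simp add: bij_betw_def Idm_D)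
  fix s s' assume "s \<in> rst_idems D X" "s' \<in> rst_idems D X"
  then obtain e e' where e: "e \<in> rst_idems E X" "s = cls e e" and e': "e' \<in> rst_idems E X" "s' = cls e' e'"
    unfolding rst_idems_D by blast
  have ar: "e \<in> Arr E" "R e = e" "Dom E e = X" "Cod E e = X" "e' \<in> Arr E" "R e' = e'" "Dom E e' = X" "Cod E e' = X"
    using e e' by (auto simp: rst_idems_def hom_def)
  have ee: "e \<cdot> e' \<in> rst_idems E X" using ar E.idem_Comp(2)[of e e'] by (simp add: rst_idems_def hom_def)
  note sp = q(2)[OF e(1)] q(2)[OF e'(1)]
  have "cls e' e' \<in> hom D X X" using sp ar by (intro hom_DI) simp_all
  then have "rle D s s' \<longleftrightarrow> cls e e \<cdot>\<^bsub>D\<^esub> cls e' e' = cls e e"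
    unfolding rle_def e(2) e'(2) using ar sp Rst_D[OF sp(1), of e] by simp
  also have "\<dots> \<longleftrightarrow> e \<cdot> e' = e"
  proof
    assume "cls e e \<cdot>\<^bsub>D\<^esub> cls e' e' = cls e e"
    then have "cls (e \<cdot> e') (e \<cdot> e') = cls e e" using Comp_idems[of e e'] ar by simp
    then have "P (e \<cdot> e') = P e" using q(1)[OF ee] q(1)[OF e(1)] by metis
    then show "e \<cdot> e' = e" by (rule inj[OF ee e(1)])
  next
    assume "e \<cdot> e' = e"
    then show "cls e e \<cdot>\<^bsub>D\<^esub> cls e' e' = cls e e" using Comp_idems[of e e'] ar by simp
  qed
  also have "\<dots> \<longleftrightarrow> rle E e e'"
    using ar by (simp add: rle_def hom_def)
  also have "\<dots> \<longleftrightarrow> rle B (amap q s) (amap q s')"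
    using idems_order[of X e e'] X e e' q by simp
  finally show "rle D s s' \<longleftrightarrow> rle B (amap q s) (amap q s')" .
qed

end

section \<open>The double dual\<close>

text \<open>The inverse maps inherit each law by applying \<open>G\<close> and cancelling. The
  functor built below runs from \<open>E\<close> to the double dual, whence the order of
  \<open>C'\<close> and \<open>C\<close> in the conclusion.\<close>

lemma rcat_isomorphic_if_bij:
  assumes "restriction_functor C C' G"
    and bo: "bij_betw (omap G) (Obj C) (Obj C')" and ba: "bij_betw (amap G) (Arr C) (Arr C')"
  shows "rcat_isomorphic C' C"
proof -
  interpret G: restriction_functor C C' G by fact
  define F where "F = \<lparr>omap = inv_into (Obj C) (omap G), amap = inv_into (Arr C) (amap G)\<rparr>"
  have Fo: "omap F Y \<in> Obj C" "omap G (omap F Y) = Y" if "Y \<in> Obj C'" for Y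
    using bo that by (auto simp: F_def bij_betw_def inv_into_into f_inv_into_f)
  have Fo': "omap F (omap G X) = X" if "X \<in> Obj C" for X
    using bo that by (auto simp: F_def bij_betw_def)
  have Fa: "amap F g \<in> Arr C" "amap G (amap F g) = g" if "g \<in> Arr C'" for g
    using ba that by (auto simp: F_def bij_betw_def inv_into_into f_inv_into_f)
  have Fa': "amap F (amap G f) = f" if "f \<in> Arr C" for f
    using ba that by (auto simp: F_def bij_betw_def)
  have dom: "Dom C (amap F g) = omap F (Dom C' g)" "Cod C (amap F g) = omap F (Cod C' g)" if g: "g \<in> Arr C'" for g
    using G.Dom_amap[OF Fa(1)[OF g]] G.Cod_amap[OF Fa(1)[OF g]] Fa[OF g] Fo' by simp_all
  have "restriction_functor C' C F"
  proof (intro restriction_functor.intro restriction_semifunctor.intro G.E.restriction_category_axioms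
      G.B.restriction_category_axioms restriction_semifunctor_axioms.intro restriction_functor_axioms.intro)
    show "omap F X \<in> Obj C" if "X \<in> Obj C'" for X using Fo that by simp
    show "amap F f \<in> hom C (omap F X) (omap F Y)" if "f \<in> hom C' X Y" for f X Y
      using that Fa dom by (auto simp: hom_def)
    show "amap F (f \<cdot>\<^bsub>C'\<^esub> g) = amap F f \<cdot>\<^bsub>C\<^esub> amap F g" if "f \<in> hom C' X Y" "g \<in> hom C' Y Z" for f g X Y Z
      using that Fa'[of "amap F f \<cdot>\<^bsub>C\<^esub> amap F g"] Fa dom by (simp add: hom_def)
    show "amap F (Rst C' f) = Rst C (amap F f)" if "f \<in> hom C' X Y" for f X Y
      using that Fa'[of "Rst C (amap F f)"] Fa by (simp add: hom_def)
    show "amap F (Idm C' X) = Idm C (omap F X)" if "X \<in> Obj C'" for X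
      using that Fa'[of "Idm C (omap F X)"] Fo G.amap_Idm by simp
  qed
  then show ?thesis
    unfolding rcat_isomorphic_def using assms(1) Fo Fo' Fa Fa' by blast
qed

context hyperfib
begin

interpretation D: hyperfib D B q
  by (rule dual_hyperfib)

section \<open>Subvertical and prone arrows of \<open>E\<close> inside the dual\<close>

definition subvertical_class :: "'m \<Rightarrow> ('m \<times> 'm) set" where
  "subvertical_class v = cls v (R v)"

lemma subvertical_class_span: "sub v \<Longrightarrow> (v, R v) \<in> spans"
  by (intro spansI pr_R) (simp_all add: sub_Rst)

lemma subvertical_class_simps [simp]:
  assumes "sub v"
  shows "subvertical_class v \<in> Arr D" "Dom D (subvertical_class v) = Cod E v" "Cod D (subvertical_class v) = Dom E v" "amap q (subvertical_class v) = P v"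
  using subvertical_class_span[OF assms] assms by (simp_all add: subvertical_class_def sub_Rst)

lemma D_sub_subvertical_class: "sub v \<Longrightarrow> D.sub (subvertical_class v)"
  by (intro D.subI) (simp_all add: sub_Rst)

text \<open>If the class of \<open>(v, c)\<close> is subvertical, then \<open>c\<close> is both
  prone and subvertical. The filler \<open>k\<close> of its hat through \<open>c\<close> goes
  backwards along \<open>c\<close> and is a comparison from \<open>(k \<cdot> v, ?e)\<close> to
  \<open>(v, c)\<close>, which replaces the right leg by an idempotent.\<close>

lemma D_sub_obtain_subvertical_class:
  assumes V: "D.sub V"
  obtains v where "sub v" "V = subvertical_class v"
proof -
  obtain v c where s: "(v, c) \<in> spans" "V = cls v c" using D.sub_Arr[OF V] by (auto simp: Arr_D)
  note d = spansD[OF s(1)]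
  have Rc: "RB (P c) = P c" using D.sub_Rst[OF V] s by simp
  have sc: "sub c" using d Rc by (intro subI)
  let ?e = "hat E p c"
  note e = hat[OF sc]
  have oc: "omap p (Cod E c) = omap p (Dom E c)" by (rule sub_omap[OF sc])
  obtain k where k: "sub k" "Dom E k = Dom E ?e" "Cod E k = Dom E c" "P k = RB (P ?e)" "k \<cdot> c = ?e"
    by (rule subvertical_lift[OF d(2), of ?e]) (use e oc Rc sub_idem[OF sc] in simp_all)
  have [simp]: "k \<in> Arr E" "v \<in> Arr E" "Dom E v = Dom E c" using k d by simp_all
  have Pkv: "P (k \<cdot> v) = P c" using k e Rc d(7) sub_idem[OF sc] by simp
  have skv: "sub (k \<cdot> v)" using Pkv Rc k by (intro subI) simp_all
  have "R (k \<cdot> v) = R ?e" by (rule R_reflect) (use Pkv e k in simp_all)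
  then have Re: "R (k \<cdot> v) = ?e" using e by simp
  have sp: "(k \<cdot> v, ?e) \<in> spans" using subvertical_class_span[OF skv] Re by simp
  have "((k \<cdot> v, ?e), (v, c)) \<in> span_rel E B p"
    by (rule span_relI[OF sp s(1), of k]) (use e k in simp_all)
  then have "V = subvertical_class (k \<cdot> v)" unfolding subvertical_class_def Re s(2) by (simp add: cls_eqI)
  then show ?thesis using that skv by blast
qed

lemma subvertical_class_Comp:
  assumes v: "sub v" and w: "sub w" and [simp]: "Cod E v = Dom E w"
  shows "subvertical_class w \<cdot>\<^bsub>D\<^esub> subvertical_class v = subvertical_class (v \<cdot> w)"
proof -
  have [simp]: "v \<in> Arr E" "w \<in> Arr E" using v w by simp_all
  have o: "omap p (Dom E v) = omap p (Dom E w)" using sub_omap[OF v] by simp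
  have c: "P w \<cdot>\<^bsub>B\<^esub> P v = P v \<cdot>\<^bsub>B\<^esub> P w" "RB (P v \<cdot>\<^bsub>B\<^esub> P w) = P v \<cdot>\<^bsub>B\<^esub> P w"
    using B.idem_Comp[of "P v" "P w"] o sub_Rst[OF v] sub_Rst[OF w] sub_omap[OF w] by simp_all
  have "dual_square (R (v \<cdot> w)) v (v \<cdot> R w) (R w)"
    unfolding dual_square_def using pr_R[of "R (v \<cdot> w)"] pr_R[of "R w"] v c sub_Rst[OF w] E.Comp_Rst[of v w, symmetric]
    by (simp add: E.assoc)
  from Comp_D[OF subvertical_class_span[OF w] subvertical_class_span[OF v] this]
  show ?thesis unfolding subvertical_class_def using E.Rst_le_right[of v w] by (simp add: E.assoc)
qed

lemma prone_class_Comp: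
  assumes "pr d" "pr c" "Cod E d = Dom E c"
  shows "prone_class d \<cdot>\<^bsub>D\<^esub> prone_class c = prone_class (d \<cdot> c)"
  using Comp_prone_class[OF prone_class_span[OF assms(1)] assms(2,3)] assms E.Rst_le_right[of d c] by (simp add: prone_class_def)

text \<open>The hypotheses say that \<open>w \<cdot> d\<close> is the factorization of a prone arrow
  followed by a subvertical one. In the dual both composites are represented by the span
  \<open>(w, c \<cdot> R v)\<close>, so the square survives with its subvertical sides
  reversed.\<close>

lemma prone_class_subvertical_class_swap:
  assumes c: "pr c" and v: "sub v" and w: "sub w" and d: "pr d"
    and [simp]: "Cod E c = Dom E v" "Dom E w = Dom E c" "Cod E w = Dom E d" "Cod E d = Cod E v"
    and sq: "c \<cdot> v = w \<cdot> d" and Pw: "P w = RB (P d)" and Pd: "P d = P c \<cdot>\<^bsub>B\<^esub> P v"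
  shows "prone_class d \<cdot>\<^bsub>D\<^esub> subvertical_class v = subvertical_class w \<cdot>\<^bsub>D\<^esub> prone_class c"
proof -
  have [simp]: "c \<in> Arr E" "v \<in> Arr E" "w \<in> Arr E" "d \<in> Arr E" using assms by simp_all
  have o: "omap p (Cod E v) = omap p (Dom E v)" by (rule sub_omap[OF v])
  have "P w \<cdot>\<^bsub>B\<^esub> P d = P d" unfolding Pw by simp
  then have "R (w \<cdot> d) = R w" using Pw by (intro R_reflect) simp_all
  then have wd: "w \<cdot> R d = w" and Rw: "R (c \<cdot> v) = R w"
    using E.Comp_Rst_eq_iff[of w d] sq by simp_all
  have cw: "R w \<cdot> c = c \<cdot> R v" using E.Comp_Rst[of c v] Rw by simp
  have PdPv: "P d \<cdot>\<^bsub>B\<^esub> P v = P c \<cdot>\<^bsub>B\<^esub> P v" unfolding Pd using o by (simp add: B.assoc sub_idem[OF v])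
  have "pr (c \<cdot> R v)" using pr_Comp[OF c pr_R[of "R v"]] by simp
  then have "dual_square (c \<cdot> R v) v w d"
    unfolding dual_square_def using v d sq Pw Pd PdPv sub_Rst[OF v] o by (simp add: E.assoc)
  from Comp_D[OF prone_class_span[OF d] subvertical_class_span[OF v] this]
  have 1: "prone_class d \<cdot>\<^bsub>D\<^esub> subvertical_class v = cls w (c \<cdot> R v)"
    unfolding prone_class_def subvertical_class_def using wd by (simp add: E.assoc)
  have "subvertical_class w \<cdot>\<^bsub>D\<^esub> prone_class c = cls (R (R w \<cdot> c) \<cdot> w) (R w \<cdot> c)"
    unfolding subvertical_class_def by (rule Comp_prone_class[OF subvertical_class_span[OF w] c]) simp
  then show ?thesis using 1 cw Rw by simp
qed

section \<open>Factorizations in \<open>E\<close> and spans in the dual\<close>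

definition factorization :: "'m \<Rightarrow> 'm \<Rightarrow> 'm \<Rightarrow> bool" where
  "factorization f v c \<longleftrightarrow> sub v \<and> pr c \<and> Cod E v = Dom E c \<and> v \<cdot> c = f \<and> P v = RB (P c)"

lemma factorizationD:
  assumes "factorization f v c"
  shows "sub v" "pr c" "v \<in> Arr E" "c \<in> Arr E" "Cod E v = Dom E c" "v \<cdot> c = f" "P v = RB (P c)"
    "f \<in> Arr E" "Dom E f = Dom E v" "Cod E f = Cod E c" "P f = P c" "R f = R v"
proof -
  show 1: "sub v" "pr c" "v \<in> Arr E" "c \<in> Arr E" "Cod E v = Dom E c" "v \<cdot> c = f" "P v = RB (P c)"
    using assms by (auto simp: factorization_def)
  then show 2: "f \<in> Arr E" "Dom E f = Dom E v" "Cod E f = Cod E c" by auto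
  have "P (v \<cdot> c) = P c" using 1(3-5,7) by simp
  then show 3: "P f = P c" using 1 by simp
  show "R f = R v" using 1(3,4,7) 2 3 by (intro R_reflect) simp_all
qed

lemma factorization_exists:
  assumes "f \<in> Arr E"
  obtains v c where "factorization f v c"
  using factorize[OF assms] unfolding factorization_def by metis

lemma factorization_span:
  assumes "factorization f v c"
  shows "(subvertical_class v, prone_class c) \<in> D.spans"
  using factorizationD[OF assms] by (intro D.spansI D_sub_subvertical_class prone_class_prone) simp_all

text \<open>The filler of \<open>c\<close> through \<open>c'\<close> is subvertical, but also prone
  by cancellation; so it has a class \<open>prone_class a\<close> in the dual, where it can compare
  spans.\<close>

lemma factorization_compare:
  assumes "pr c" "pr c'" "P c = P c'" "Cod E c = Cod E c'"
  obtains a where "pr a" "Dom E a = Dom E c" "Cod E a = Dom E c'" "P a = RB (P c)" "a \<cdot> c' = c" "a \<cdot> R c' = a"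
proof -
  have [simp]: "c \<in> Arr E" "c' \<in> Arr E" using assms by simp_all
  have o: "omap p (Dom E c) = omap p (Dom E c')" using Dom_amap[of c] Dom_amap[of c'] assms(3) by simp
  obtain a where a: "sub a" "Dom E a = Dom E c" "Cod E a = Dom E c'" "P a = RB (P c)" "a \<cdot> c' = c" "a \<cdot> R c' = a"
    by (rule subvertical_lift[OF assms(2), of c]) (use assms o in simp_all)
  moreover have "pr a" by (rule pr_cancel[OF assms(2)]) (use a assms in simp_all)
  ultimately show ?thesis using that by blast
qed

lemma factorization_cls_eq:
  assumes f: "factorization f v c" and f': "factorization f v' c'"
  shows "D.cls (subvertical_class v) (prone_class c) = D.cls (subvertical_class v') (prone_class c')"
proof -
  note d = factorizationD[OF f] and d' = factorizationD[OF f']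
  have Pc: "P c = P c'" using d(11) d'(11) by simp
  have Cc: "Cod E c = Cod E c'" using d(10) d'(10) by simp
  have Dv: "Dom E v' = Dom E v" using d(9) d'(9) by simp
  obtain a where a: "pr a" "Dom E a = Dom E c" "Cod E a = Dom E c'" "P a = RB (P c)" "a \<cdot> c' = c" "a \<cdot> R c' = a"
    using factorization_compare[OF d(2) d'(2) Pc Cc] .
  have [simp]: "a \<in> Arr E" "v \<in> Arr E" "c \<in> Arr E" "v' \<in> Arr E" "c' \<in> Arr E" using a d d' by simp_all
  have va: "v \<cdot> a = v'"
  proof (rule pr_unique[OF d'(2)])
    show "v \<cdot> a \<cdot> c' = v' \<cdot> c'" using a d(5,6) d'(6) by (simp add: E.assoc)
    show "P (v \<cdot> a) = P v'" using a(2,4) d(5,7) d'(7) Pc by simp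
    show "v \<cdot> a \<cdot> R c' = v \<cdot> a" using a d(5) by (simp add: E.assoc)
  qed (use a d(5) d'(5) in simp_all)
  have Pv: "P v' = P v" using d(7) d'(7) Pc by simp
  \<comment> \<open>The swap is applied to \<open>R v \<cdot> v' = v \<cdot> a\<close>, with the
    idempotent \<open>R v\<close> as the prone arrow; its class is then absorbed by that of
    \<open>v\<close>.\<close>
  have "prone_class a \<cdot>\<^bsub>D\<^esub> subvertical_class v' = subvertical_class v \<cdot>\<^bsub>D\<^esub> prone_class (R v)"
  proof (rule prone_class_subvertical_class_swap)
    show "pr (R v)" by (rule pr_R) simp_all
    show "R v \<cdot> v' = v \<cdot> a" using va d(12) d'(12)[symmetric] E.Rst_Comp_self[of v'] by simp
    show "P a = P (R v) \<cdot>\<^bsub>B\<^esub> P v'" using a(4) Pv d(7) sub_idem[OF d(1)] by simp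
  qed (use a d(1,5,7) d'(1,5) Dv in simp_all)
  also have "\<dots> = subvertical_class v"
    using Comp_prone_class[OF subvertical_class_span[OF d(1)] pr_R[of "R v"]] by (simp add: subvertical_class_def)
  finally have av: "prone_class a \<cdot>\<^bsub>D\<^esub> subvertical_class v' = subvertical_class v" .
  have "((subvertical_class v, prone_class c), (subvertical_class v', prone_class c')) \<in> span_rel D B q"
    by (rule D.span_relI[OF factorization_span[OF f] factorization_span[OF f'], of "prone_class a"])
      (use a d d' Pc Cc av prone_class_Comp[OF a(1) d'(2) a(3)] in simp_all)
  then show ?thesis by (rule D.cls_eqI)
qed

text \<open>Proneness in the dual forces the comparison \<open>A\<close> to be the class of the
  arrow \<open>a\<close> of \<open>E\<close>. Its compatibility with the left legs is an equality of
  span classes over \<open>E\<close>, and unpacking it gives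
  \<open>v \<cdot> a = R v \<cdot> v'\<close>; composing with \<open>c'\<close> then yields
  \<open>f = f'\<close>.\<close>

lemma factorization_cls_inj:
  assumes f: "factorization f v c" and f': "factorization f' v' c'" and eq: "D.cls (subvertical_class v) (prone_class c) = D.cls (subvertical_class v') (prone_class c')"
  shows "f = f'"
proof -
  note d = factorizationD[OF f] and d' = factorizationD[OF f']
  have "((subvertical_class v, prone_class c), (subvertical_class v', prone_class c')) \<in> span_rel D B q"
    using eq D.cls_eq_iff factorization_span f f' by blast
  note r = D.span_relD[OF this]
  obtain A where A: "A \<in> Arr D" "Dom D A = Dom E c" "Cod D A = Dom E c'" "amap q A = RB (P c)"
      "A \<cdot>\<^bsub>D\<^esub> prone_class c' = prone_class c" "A \<cdot>\<^bsub>D\<^esub> subvertical_class v' = subvertical_class v"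
    using r(6) d(2) d'(2) by auto
  have Pc: "P c = P c'" and Cc: "Cod E c = Cod E c'" and Dv: "Dom E v = Dom E v'"
    using r(3-5) d(1,2) d'(1,2) by simp_all
  obtain a where a: "pr a" "Dom E a = Dom E c" "Cod E a = Dom E c'" "P a = RB (P c)" "a \<cdot> c' = c" "a \<cdot> R c' = a"
    using factorization_compare[OF d(2) d'(2) Pc Cc] .
  have [simp]: "a \<in> Arr E" "v \<in> Arr E" "c \<in> Arr E" "v' \<in> Arr E" "c' \<in> Arr E" using a d d' by simp_all
  have ac: "prone_class a \<cdot>\<^bsub>D\<^esub> prone_class c' = prone_class c" using prone_class_Comp[OF a(1) d'(2) a(3)] a(5) by simp
  have "Rst D (prone_class c) = Rst D (prone_class a)" by (rule D.R_reflect) (use a d in simp_all)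
  then have "prone_class a \<cdot>\<^bsub>D\<^esub> Rst D (prone_class c') = prone_class a"
    using D.E.Comp_Rst_eq_iff[of "prone_class a" "prone_class c'"] ac a d' by simp
  then have "prone_class a = A"
    using a A ac d'(2) by - (rule D.pr_unique[OF prone_class_prone[OF d'(2)]], simp_all)
  then have av: "prone_class a \<cdot>\<^bsub>D\<^esub> subvertical_class v' = subvertical_class v" using A by simp
  have Cv: "Cod E a = Cod E v'" using a(3) d'(5) by simp
  obtain m u where g: "dual_square m v' u a" and "cls (R a) a \<cdot>\<^bsub>D\<^esub> cls v' (R v') = cls (u \<cdot> R a) (m \<cdot> R v')"
    using Comp_cls_exists[OF prone_class_span[OF a(1)] subvertical_class_span[OF d'(1)] Cv] .
  then have "cls v (R v) = cls (u \<cdot> R a) (m \<cdot> R v')" using av by (simp add: prone_class_def subvertical_class_def)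
  then have "((v, R v), (u \<cdot> R a, m \<cdot> R v')) \<in> span_rel E B p"
    using cls_eq_iff subvertical_class_span[OF d(1)] spans_Comp(1)[OF prone_class_span[OF a(1)] subvertical_class_span[OF d'(1)] g] by blast
  note t = span_relD(6)[OF this] and gd = dual_squareD[OF g] and gf = dual_square_facts[OF g]
  have [simp]: "m \<in> Arr E" "u \<in> Arr E" "Cod E m = Dom E v'" "Cod E u = Dom E a" "Dom E m = Dom E u" using gd by simp_all
  obtain b where b: "b \<in> Arr E" "Cod E b = Dom E u" "b \<cdot> m = R v" "b \<cdot> u = v"
    using t gf(4,5) by auto
  have "v \<cdot> a = b \<cdot> (m \<cdot> v')" using b gd(9) Cv by (simp add: E.assoc[symmetric])
  then have va: "v \<cdot> a = R v \<cdot> v'" using b by (simp add: E.assoc[symmetric])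
  have Rff: "R f = R f'" by (rule R_reflect) (use d d' Pc Dv in simp_all)
  have "f = v \<cdot> a \<cdot> c'" using d(5,6) a(2,3,5) by (simp add: E.assoc)
  also have "\<dots> = R v \<cdot> f'" unfolding va using d'(5,6) Dv by (simp add: E.assoc)
  also have "\<dots> = f'" using Rff d(12) d'(8) by simp
  finally show ?thesis .
qed

text \<open>A prone lift \<open>c\<close> in \<open>E\<close> of the image of \<open>K\<close> gives
  a prone class with the same image. The comparison \<open>b\<close> from it to \<open>K\<close>
  moves the span to \<open>(b V, prone_class c)\<close>, whose left leg is again subvertical and
  thus comes from \<open>E\<close>.\<close>

lemma factorization_cls_surj:
  assumes "s \<in> Arr D.D"
  obtains f v c where "factorization f v c" "s = D.cls (subvertical_class v) (prone_class c)"
proof -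
  obtain V K where s: "(V, K) \<in> D.spans" "s = D.cls V K"
    using assms by (auto simp: D.Arr_D)
  note d = D.spansD[OF s(1)]
  have KI: "amap q K \<cdot>\<^bsub>B\<^esub> P (Idm E (Cod D K)) = amap q K"
    using D.P_Idm_right[of K "Cod D K"] d(4) Idm_span[of "Cod D K"] D.E.Cod_in[of K] by (simp add: Idm_D)
  obtain c where c: "pr c" "Cod E c = Cod D K" "P c = amap q K" "omap p (Dom E c) = omap p (Dom D K)"
    using pr_lift_of[of "Cod D K" "amap q K"] d(4) KI D.E.Cod_in[of K] D.Dom_amap[of K] D.Cod_amap[of K] by auto
  obtain b where b: "D.sub b" "Dom D b = Dom E c" "Cod D b = Dom D K" "amap q b = RB (P c)" "b \<cdot>\<^bsub>D\<^esub> K = prone_class c"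
    by (rule D.subvertical_lift[OF d(2), of "prone_class c"]) (use c d(4) in simp_all)
  have [simp]: "b \<in> Arr D" "V \<in> Arr D" "K \<in> Arr D" "Dom D V = Dom D K" using b d by simp_all
  have Pb: "amap q (b \<cdot>\<^bsub>D\<^esub> V) = RB (P c)"
    using b(3,4) d(4,7) c by simp
  have sb: "D.sub (b \<cdot>\<^bsub>D\<^esub> V)" using Pb b(3) c(1) by (intro D.subI) simp_all
  have sp: "(b \<cdot>\<^bsub>D\<^esub> V, prone_class c) \<in> D.spans"
    by (rule D.spansI[OF sb prone_class_prone[OF c(1)]]) (use Pb b c in simp_all)
  have "((b \<cdot>\<^bsub>D\<^esub> V, prone_class c), (V, K)) \<in> span_rel D B q"
    by (rule D.span_relI[OF sp s(1), of b]) (use b c in simp_all)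
  then have eq: "s = D.cls (b \<cdot>\<^bsub>D\<^esub> V) (prone_class c)" unfolding s(2) by (simp add: D.cls_eqI)
  obtain v where v: "sub v" "b \<cdot>\<^bsub>D\<^esub> V = subvertical_class v" using D_sub_obtain_subvertical_class[OF sb] .
  have "Dom D (subvertical_class v) = Dom E c" unfolding v(2)[symmetric] using b(2,3) by simp
  then have "factorization (v \<cdot> c) v c" unfolding factorization_def using v c(1) Pb by simp
  then show ?thesis using that eq v by simp
qed

section \<open>The comparison functor into the double dual\<close>

definition double_dual_map :: "'m \<Rightarrow> (('m \<times> 'm) set \<times> ('m \<times> 'm) set) set" where
  "double_dual_map f = (THE s. \<exists>v c. factorization f v c \<and> s = D.cls (subvertical_class v) (prone_class c))"

lemma double_dual_map_eq:
  assumes "factorization f v c"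
  shows "double_dual_map f = D.cls (subvertical_class v) (prone_class c)"
  unfolding double_dual_map_def using assms factorization_cls_eq by (intro the_equality) blast+

lemma factorization_Rst: "f \<in> Arr E \<Longrightarrow> R f = f \<Longrightarrow> factorization f f f"
  using pr_R[of f] sub_R[of f] idemD[of f] by (simp add: factorization_def)

lemma subvertical_class_idem: "R e = e \<Longrightarrow> subvertical_class e = cls e e"
  and prone_class_idem: "R e = e \<Longrightarrow> prone_class e = cls e e"
  by (simp_all add: subvertical_class_def prone_class_def)

lemma double_dual_map_functor: "restriction_functor E D.D \<lparr>omap = \<lambda>X. X, amap = double_dual_map\<rparr>"
proof (intro restriction_functor.intro restriction_semifunctor.intro E.restriction_category_axioms
      D.dual_restriction_category restriction_semifunctor_axioms.intro restriction_functor_axioms.intro,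
      unfold fmap.simps)
  show "X \<in> Obj D.D" if "X \<in> Obj E" for X using that by simp
  show "double_dual_map f \<in> hom D.D X Y" if f: "f \<in> hom E X Y" for f X Y
  proof -
    obtain v c where fc: "factorization f v c" using f factorization_exists[of f] by (auto simp: hom_def)
    note d = factorizationD[OF fc]
    show ?thesis unfolding double_dual_map_eq[OF fc]
      by (rule D.hom_DI[OF factorization_span[OF fc]]) (use d f in \<open>simp_all add: hom_def\<close>)
  qed
  show "double_dual_map (f \<cdot> g) = double_dual_map f \<cdot>\<^bsub>D.D\<^esub> double_dual_map g" if fg: "f \<in> hom E X Y" "g \<in> hom E Y Z" for f g X Y Z
  proof -
    obtain v1 c1 where f1: "factorization f v1 c1" using fg factorization_exists[of f] by (auto simp: hom_def)
    obtain v2 c2 where f2: "factorization g v2 c2" using fg factorization_exists[of g] by (auto simp: hom_def)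
    note d1 = factorizationD[OF f1] and d2 = factorizationD[OF f2]
    have [simp]: "v1 \<in> Arr E" "c1 \<in> Arr E" "v2 \<in> Arr E" "c2 \<in> Arr E" "Cod E v1 = Dom E c1" "Cod E v2 = Dom E c2"
      using d1 d2 by simp_all
    have [simp]: "Cod E c1 = Dom E v2" using fg d1(10) d2(9) by (simp add: hom_def)
    have o: "omap p (Dom E v2) = omap p (Dom E c2)" using sub_omap[OF d2(1)] by simp
    obtain w d where w: "sub w" "pr d" "Dom E w = Dom E c1" "Cod E w = Dom E d" "Cod E d = Dom E c2"
      "w \<cdot> d = c1 \<cdot> v2" "P w = RB (P d)" "P d = P c1 \<cdot>\<^bsub>B\<^esub> P v2"
      using factorize[of "c1 \<cdot> v2"] by auto
    have [simp]: "w \<in> Arr E" "d \<in> Arr E" using w by simp_all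
    have "prone_class d \<cdot>\<^bsub>D\<^esub> subvertical_class v2 = subvertical_class w \<cdot>\<^bsub>D\<^esub> prone_class c1"
      by (rule prone_class_subvertical_class_swap) (use w d1(2) d2(1) in simp_all)
    then have "D.dual_square (prone_class d) (subvertical_class v2) (subvertical_class w) (prone_class c1)"
      unfolding D.dual_square_def using w d1(2) d2(1) prone_class_prone D_sub_subvertical_class by simp
    from D.Comp_D[OF factorization_span[OF f1] factorization_span[OF f2] this]
    have "double_dual_map f \<cdot>\<^bsub>D.D\<^esub> double_dual_map g = D.cls (subvertical_class (v1 \<cdot> w)) (prone_class (d \<cdot> c2))"
      unfolding double_dual_map_eq[OF f1] double_dual_map_eq[OF f2] using subvertical_class_Comp[of v1 w] prone_class_Comp[of d c2] w d1(1) d2(2) by simp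
    moreover have "factorization (f \<cdot> g) (v1 \<cdot> w) (d \<cdot> c2)"
      unfolding factorization_def
    proof (intro conjI)
      have "v1 \<cdot> w \<cdot> (d \<cdot> c2) = v1 \<cdot> (w \<cdot> d) \<cdot> c2" using w(3-5) by (simp add: E.assoc)
      also have "\<dots> = v1 \<cdot> c1 \<cdot> (v2 \<cdot> c2)" unfolding w(6) by (simp add: E.assoc)
      finally show "v1 \<cdot> w \<cdot> (d \<cdot> c2) = f \<cdot> g" using d1(6) d2(6) by simp
      have "P v2 \<cdot>\<^bsub>B\<^esub> P c2 = P c2" unfolding d2(7) by simp
      then have "P (d \<cdot> c2) = P c1 \<cdot>\<^bsub>B\<^esub> P c2" using w(5,8) o by (simp add: B.assoc)
      then have 1: "RB (P (d \<cdot> c2)) = RB (P d)"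
        using w(8) d2(7) B.Rst_Comp_Rst[of "P c1" "P c2"] o by simp
      have "P (v1 \<cdot> w) = RB (P d)"
        using w(3,7,8) d1(7) B.Rst_le_left[of "P c1" "P v2"] by simp
      then show 2: "P (v1 \<cdot> w) = RB (P (d \<cdot> c2))" using 1 by simp
      show "sub (v1 \<cdot> w)" using 2 w(3-5) by (intro subI) simp_all
      show "pr (d \<cdot> c2)" using pr_Comp w(2,5) d2(2) by simp
    qed (use w(3-5) in simp_all)
    ultimately show ?thesis using double_dual_map_eq by simp
  qed
  show "double_dual_map (R f) = Rst D.D (double_dual_map f)" if f: "f \<in> hom E X Y" for f X Y
  proof -
    obtain v c where fc: "factorization f v c" using f factorization_exists[of f] by (auto simp: hom_def)
    note d = factorizationD[OF fc]
    have e: "R f \<in> Arr E" "R (R f) = R f" using d by simp_all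
    note sp = idem_span[OF e]
    have "double_dual_map (R f) = D.cls (cls (R f) (R f)) (cls (R f) (R f))"
      using double_dual_map_eq[OF factorization_Rst[OF e]] subvertical_class_idem[OF e(2)] prone_class_idem[OF e(2)] by simp
    also have "\<dots> = Rst D.D (double_dual_map f)"
      unfolding double_dual_map_eq[OF fc]
      by (rule D.Rst_D[OF factorization_span[OF fc], symmetric])
        (use sp e d Rst_D[OF sp e] in simp_all)
    finally show ?thesis .
  qed
  show "double_dual_map (Idm E X) = Idm D.D X" if X: "X \<in> Obj E" for X
    using double_dual_map_eq[OF factorization_Rst[of "Idm E X"]] subvertical_class_idem[of "Idm E X"] prone_class_idem[of "Idm E X"] X
    by (simp add: D.Idm_D Idm_D)
qed

lemma double_dual_isomorphic: "rcat_isomorphic (fib_dual D B q) E"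
proof (rule rcat_isomorphic_if_bij[OF double_dual_map_functor])
  show "bij_betw (omap \<lparr>omap = \<lambda>X. X, amap = double_dual_map\<rparr>) (Obj E) (Obj D.D)"
    by (simp add: bij_betw_def)
  have "inj_on double_dual_map (Arr E)"
    by (rule inj_onI) (metis factorization_exists factorization_cls_inj double_dual_map_eq)
  moreover have "double_dual_map ` Arr E = Arr D.D"
  proof
    show "double_dual_map ` Arr E \<subseteq> Arr D.D"
    proof
      fix s assume "s \<in> double_dual_map ` Arr E"
      then obtain f v c where "factorization f v c" "s = double_dual_map f" using factorization_exists by blast
      then show "s \<in> Arr D.D" using double_dual_map_eq factorization_span by simp
    qed
    show "Arr D.D \<subseteq> double_dual_map ` Arr E"
    proof
      fix s assume "s \<in> Arr D.D"
      then obtain f v c where "factorization f v c" "s = D.cls (subvertical_class v) (prone_class c)" by (rule factorization_cls_surj)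
      then show "s \<in> double_dual_map ` Arr E" using double_dual_map_eq factorizationD(8) by blast
    qed
  qed
  ultimately show "bij_betw (amap \<lparr>omap = \<lambda>X. X, amap = double_dual_map\<rparr>) (Arr E) (Arr D.D)"
    by (simp add: bij_betw_def)
qed

end

theorem corollary6p11:
  fixes E :: "('o, 'm) rcat" and B :: "('p, 'n) rcat" and p :: "('o, 'm, 'p, 'n) fmap"
  assumes "latent_hyperfibration E B p"
  shows "rcat_isomorphic (fib_dual (fib_dual E B p) B (fib_dual_proj E B p)) E"
proof -
  interpret hyperfib E B p
    using assms by (rule hyperfib.intro)
  show ?thesis
    by (rule double_dual_isomorphic)
qed

end
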